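(* Let $R$ be a Noetherian, universally catenary, perinormal integral domain whose integral closure $S$ (in its fraction field) is finitely generated as an $R$-module. Let $X$ be an (analytic) indeterminate. Then the integral domains $R+XS[X]\subseteq S[X]$ and $R+XS[[X]]\subseteq S[[X]]$ are perinormal.
   Context: All rings are commutative with identity; "local" means having a unique maximal ideal (no Noetherian assumption). An overring of an integral domain $R$ is a ring between $R$ and its fraction field. A ring extension $R\subseteq T$ satisfies going-down if whenever $\mathfrak p_1\subseteq\mathfrak p_2$ are primes of $R$ and $Q_2\in\operatorname{Spec}T$ satisfies $Q_2\cap R=\mathfrak p_2$, there is $Q_1\in\operatorname{Spec}T$ with $Q_1\subseteq Q_2$ and $Q_1\cap R=\mathfrak p_1$. An integral domain $R$ is perinormal if every local overring $L$ of $R$ such that $R\subseteq L$ satisfies going-down is a localization of $R$ (i.e. $L=R_{\mathfrak p}$ for some $\mathfrak p\in\operatorname{Spec}R$). *)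

theory Defs
  imports
    "HOL-Algebra.Algebraic_Closure_Type"
    "HOL-Algebra.Ring_Divisibility"
    "HOL-Algebra.Generated_Rings"
    "HOL-Computational_Algebra.Polynomial_Factorial"
    "HOL-Computational_Algebra.Formal_Power_Series"
begin

text \<open>
  An integral domain is represented as a subring \<open>D\<close> of a field type; every integral domain is of
  this form up to isomorphism. The ambient field may be larger than the fraction field of \<open>D\<close>, so
  the latter is always formed explicitly inside the ambient field. The record \<open>subring_on D\<close> gives
  access to the notions of HOL-Algebra (prime ideals, maximal ideals, Noetherian rings, ...).
\<close>

definition subring_on :: "'k::field set \<Rightarrow> 'k ring"
  where "subring_on D = ring_of_type_algebra\<lparr>carrier := D\<rparr>"

abbreviation is_subring :: "'k::field set \<Rightarrow> bool"
  where "is_subring D \<equiv> subring D ring_of_type_algebra"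

definition frac_field :: "'k::field set \<Rightarrow> 'k set"
  where "frac_field D = {a / b | a b. a \<in> D \<and> b \<in> D \<and> b \<noteq> 0}"

definition overring :: "'k::field set \<Rightarrow> 'k set \<Rightarrow> bool"
  where "overring D L \<longleftrightarrow> is_subring L \<and> D \<subseteq> L \<and> L \<subseteq> frac_field D"

definition localization_at :: "'k::field set \<Rightarrow> 'k set \<Rightarrow> 'k set"
  where "localization_at D P = {a / b | a b. a \<in> D \<and> b \<in> D - P}"

definition local_ring :: "('a, 'm) ring_scheme \<Rightarrow> bool"
  where "local_ring A \<longleftrightarrow> cring A \<and> (\<exists>!M. maximalideal M A)"

definition going_down :: "'k::field set \<Rightarrow> 'k set \<Rightarrow> bool"
  where "going_down D T \<longleftrightarrow>
    (\<forall>P1 P2 Q2. primeideal P1 (subring_on D) \<and> primeideal P2 (subring_on D) \<and> P1 \<subseteq> P2 \<and>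
        primeideal Q2 (subring_on T) \<and> Q2 \<inter> D = P2 \<longrightarrow>
      (\<exists>Q1. primeideal Q1 (subring_on T) \<and> Q1 \<subseteq> Q2 \<and> Q1 \<inter> D = P1))"

definition perinormal :: "'k::field set \<Rightarrow> bool"
  where "perinormal D \<longleftrightarrow> is_subring D \<and>
    (\<forall>L. overring D L \<and> local_ring (subring_on L) \<and> going_down D L \<longrightarrow>
      (\<exists>P. primeideal P (subring_on D) \<and> L = localization_at D P))"

definition integral_closure :: "'k::field set \<Rightarrow> 'k set"
  where "integral_closure D =
    {x \<in> frac_field D. \<exists>p. lead_coeff p = 1 \<and> (\<forall>i. coeff p i \<in> D) \<and> poly p x = 0}"

definition fin_gen_module :: "'k::field set \<Rightarrow> 'k set \<Rightarrow> bool"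
  where "fin_gen_module D M \<longleftrightarrow>
    (\<exists>G. finite G \<and> M = {\<Sum>g\<in>G. c g * g | c. \<forall>g\<in>G. c g \<in> D})"

definition prime_chain ::
    "('a, 'm) ring_scheme \<Rightarrow> 'a set \<Rightarrow> 'a set \<Rightarrow> 'a set list \<Rightarrow> bool"
  where "prime_chain A P Q C \<longleftrightarrow> C \<noteq> [] \<and> hd C = P \<and> last C = Q \<and>
    (\<forall>I\<in>set C. primeideal I A) \<and> sorted_wrt (\<subset>) C"

definition maximal_prime_chain ::
    "('a, 'm) ring_scheme \<Rightarrow> 'a set \<Rightarrow> 'a set \<Rightarrow> 'a set list \<Rightarrow> bool"
  where "maximal_prime_chain A P Q C \<longleftrightarrow> prime_chain A P Q C \<and>
    (\<forall>C'. prime_chain A P Q C' \<and> set C \<subseteq> set C' \<longrightarrow> C' = C)"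

definition catenary :: "('a, 'm) ring_scheme \<Rightarrow> bool"
  where "catenary A \<longleftrightarrow>
    (\<forall>P Q. primeideal P A \<and> primeideal Q A \<and> P \<subseteq> Q \<longrightarrow>
      (\<exists>N. \<forall>C. prime_chain A P Q C \<longrightarrow> length C \<le> N) \<and>
      (\<forall>C C'. maximal_prime_chain A P Q C \<and> maximal_prime_chain A P Q C' \<longrightarrow>
        length C = length C'))"

definition fin_gen_algebra ::
    "('a, 'm) ring_scheme \<Rightarrow> ('b, 'n) ring_scheme \<Rightarrow> ('a \<Rightarrow> 'b) \<Rightarrow> bool"
  where "fin_gen_algebra R A \<phi> \<longleftrightarrow> cring A \<and> \<phi> \<in> ring_hom R A \<and>
    (\<exists>G. finite G \<and> G \<subseteq> carrier A \<and> carrier A = generate_ring A (\<phi> ` carrier R \<union> G))"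

text \<open>
  HOL cannot quantify over all types inside a formula, so the finitely generated \<open>R\<close>-algebras are
  taken with carrier in the type \<open>'a list\<close>. This loses nothing: a finitely generated \<open>R\<close>-algebra has
  cardinality at most the maximum of \<open>\<aleph>\<^sub>0\<close> and the cardinality of \<open>R\<close>, hence at most that of
  \<open>'a list\<close>, so an isomorphic copy of it has its carrier there; and being catenary is invariant
  under isomorphism. Noetherianity of \<open>R\<close> is not part of this definition.
\<close>

definition universally_catenary :: "('a, 'm) ring_scheme \<Rightarrow> bool"
  where "universally_catenary R \<longleftrightarrow>
    (\<forall>(A :: 'a list ring) \<phi>. fin_gen_algebra R A \<phi> \<longrightarrow> catenary A)"

text \<open>The rings \<open>R + X S[X]\<close> and \<open>R + X S[[X]]\<close>.\<close>

definition plus_X_poly :: "'k::field set \<Rightarrow> 'k set \<Rightarrow> 'k poly set"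
  where "plus_X_poly R S = {[:r:] + [:0, 1:] * f | r f. r \<in> R \<and> (\<forall>i. coeff f i \<in> S)}"

definition plus_X_fps :: "'k::field set \<Rightarrow> 'k set \<Rightarrow> 'k fps set"
  where "plus_X_fps R S = {fps_const r + fps_X * f | r f. r \<in> R \<and> (\<forall>i. fps_nth f i \<in> S)}"

end

theory Submission
  imports Defs
begin

text \<open>
  Write \<open>T\<close> for \<open>S[X]\<close> or \<open>S[[X]]\<close>, \<open>I = XT\<close> and \<open>D = R + I\<close>. The ring \<open>T\<close> is Noetherian and completely
  integrally closed, so a fraction lying outside a localization of \<open>T\<close> also lies outside the
  localization at some height-one prime \<open>q\<close> and can be written with denominator in \<open>q\<close> and numerator
  outside \<open>q\<close>.
  Going-down provides a prime of a local overring \<open>L\<close> of \<open>D\<close> over \<open>q \<inter> D\<close>. As \<open>D\<close> and \<open>T\<close> have the same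
  localization at \<open>q\<close> (if \<open>q = I\<close>, because \<open>S\<close> and \<open>R\<close> have the same fraction field), no such fraction
  lies in \<open>L\<close>; hence, for \<open>p\<close> the contraction to \<open>D\<close> of the maximal ideal of \<open>L\<close>, \<open>L\<close> is contained in
  the localization of \<open>T\<close> at the complement of \<open>p\<close> in \<open>D\<close>. If \<open>I\<close> is not contained in \<open>p\<close>, this
  localization is the one of \<open>D\<close> at \<open>p\<close>. Otherwise \<open>L\<close> contains the localized ideal \<open>I\<close>, the quotient is
  a local overring of \<open>R\<close> satisfying going-down over \<open>R\<close>, and perinormality of \<open>R\<close> applies.
\<close>

section \<open>Modules over subrings and integral closure\<close>

text \<open>Unless \<open>R = S\<close>, \<open>D\<close> is not integrally closed, while bounding
  \<open>L\<close> needs a ring whose height-one primes detect membership. Hence numerators are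
  taken from \<open>T\<close> but denominators only from \<open>D - p\<close>: a prime
  \<open>q\<close> of \<open>T\<close> that misses \<open>D - p\<close> contracts into
  \<open>p\<close>, which is exactly the situation in which going-down can descend from the maximal
  ideal of \<open>L\<close>.

  Complete integral closedness is carried along instead of integral closedness because it speaks of
  one common denominator of all powers of an element. In this form it can be read off lowest
  coefficients of power series, and polynomials inherit it. For \<open>S\<close> itself it comes
  from finiteness over the Noetherian ring \<open>R\<close>: a common denominator confines all
  powers to a finitely generated module, so the element is integral.\<close>

definition subring_set :: "'a::comm_ring_1 set \<Rightarrow> bool"
  where "subring_set D \<longleftrightarrow> 1 \<in> D \<and> (\<forall>x\<in>D. \<forall>y\<in>D. x - y \<in> D \<and> x * y \<in> D)"

text \<open>\<open>M\<close> need not lie in \<open>D\<close>: ideals, finite extensions and modules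
  over a ring of constants are all instances. Negatives come from \<open>- 1\<close> in
  \<open>D\<close>.\<close>

definition submodule_over :: "'a::comm_ring_1 set \<Rightarrow> 'a set \<Rightarrow> bool"
  where "submodule_over D M \<longleftrightarrow>
    0 \<in> M \<and> (\<forall>x\<in>M. \<forall>y\<in>M. x + y \<in> M) \<and> (\<forall>r\<in>D. \<forall>x\<in>M. r * x \<in> M)"

definition span_over :: "'a::comm_ring_1 set \<Rightarrow> 'a set \<Rightarrow> 'a set"
  where "span_over D G = {\<Sum>g\<in>G. c g * g | c. \<forall>g\<in>G. c g \<in> D}"

definition noetherian_set :: "'a::comm_ring_1 set \<Rightarrow> bool"
  where "noetherian_set D \<longleftrightarrow>
    (\<forall>N. submodule_over D N \<and> N \<subseteq> D \<longrightarrow> (\<exists>G. finite G \<and> G \<subseteq> N \<and> N \<subseteq> span_over D G))"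

text \<open>\<open>d\<close> is a common denominator of all powers of \<open>z\<close>. As
  \<open>z\<close> ranges over the ambient ring, the notion is relative to it, first to K[X] or
  K[[X]]; it becomes absolute once the ambient ring is a field.\<close>

definition completely_integrally_closed :: "'a::comm_ring_1 set \<Rightarrow> bool"
  where "completely_integrally_closed T \<longleftrightarrow>
    (\<forall>z d. d \<in> T \<and> d \<noteq> 0 \<and> (\<forall>n. d * z ^ n \<in> T) \<longrightarrow> z \<in> T)"

lemma subring_setD:
  assumes "subring_set D"
  shows "0 \<in> D" "1 \<in> D" "x \<in> D \<Longrightarrow> - x \<in> D" "x \<in> D \<Longrightarrow> y \<in> D \<Longrightarrow> x + y \<in> D"
    "x \<in> D \<Longrightarrow> y \<in> D \<Longrightarrow> x - y \<in> D" "x \<in> D \<Longrightarrow> y \<in> D \<Longrightarrow> x * y \<in> D"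
proof -
  have *: "1 \<in> D" "\<And>x y. x \<in> D \<Longrightarrow> y \<in> D \<Longrightarrow> x - y \<in> D" "\<And>x y. x \<in> D \<Longrightarrow> y \<in> D \<Longrightarrow> x * y \<in> D"
    using assms by (auto simp: subring_set_def)
  have 0: "0 \<in> D" using *(2)[OF *(1) *(1)] by simp
  have m: "- x \<in> D" if "x \<in> D" for x using *(2)[OF 0 that] by simp
  show "0 \<in> D" "1 \<in> D" "x \<in> D \<Longrightarrow> - x \<in> D" "x \<in> D \<Longrightarrow> y \<in> D \<Longrightarrow> x + y \<in> D"
    "x \<in> D \<Longrightarrow> y \<in> D \<Longrightarrow> x - y \<in> D" "x \<in> D \<Longrightarrow> y \<in> D \<Longrightarrow> x * y \<in> D"
    using * 0 m *(2)[OF _ m, of x y] by auto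
qed

lemma subring_set_sum: "subring_set D \<Longrightarrow> (\<And>i. i \<in> A \<Longrightarrow> f i \<in> D) \<Longrightarrow> sum f A \<in> D"
  by (induction A rule: infinite_finite_induct) (auto intro: subring_setD)

lemma submodule_overD:
  assumes "submodule_over D M"
  shows "0 \<in> M" "x \<in> M \<Longrightarrow> y \<in> M \<Longrightarrow> x + y \<in> M" "r \<in> D \<Longrightarrow> x \<in> M \<Longrightarrow> r * x \<in> M"
  using assms by (auto simp: submodule_over_def)

lemma submodule_over_uminus:
  "subring_set D \<Longrightarrow> submodule_over D M \<Longrightarrow> x \<in> M \<Longrightarrow> - x \<in> M"
  using submodule_overD(3)[of D M "- 1" x] subring_setD(2,3)[of D] by simp

lemma submodule_over_diff:
  "subring_set D \<Longrightarrow> submodule_over D M \<Longrightarrow> x \<in> M \<Longrightarrow> y \<in> M \<Longrightarrow> x - y \<in> M"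
  using submodule_overD(2)[of D M x "- y"] submodule_over_uminus[of D M y] by simp

lemma submodule_over_sum:
  "submodule_over D M \<Longrightarrow> (\<And>i. i \<in> A \<Longrightarrow> f i \<in> M) \<Longrightarrow> sum f A \<in> M"
  by (induction A rule: infinite_finite_induct) (auto intro: submodule_overD)

lemma submodule_over_subring: "subring_set T \<Longrightarrow> D \<subseteq> T \<Longrightarrow> submodule_over D T"
  by (auto simp: submodule_over_def intro: subring_setD)

lemma submodule_over_mono: "submodule_over T M \<Longrightarrow> D \<subseteq> T \<Longrightarrow> submodule_over D M"
  by (auto simp: submodule_over_def)

lemma submodule_over_span: 
  assumes "subring_set D"
  shows "submodule_over D (span_over D G)"
  unfolding submodule_over_def
proof (intro conjI ballI)
  show "0 \<in> span_over D G"
    unfolding span_over_def by (rule CollectI, rule exI[of _ "\<lambda>_. 0"]) (simp add: subring_setD[OF assms])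
next
  fix x y assume "x \<in> span_over D G" "y \<in> span_over D G"
  then obtain a b where "x = (\<Sum>g\<in>G. a g * g)" "y = (\<Sum>g\<in>G. b g * g)"
    "\<forall>g\<in>G. a g \<in> D" "\<forall>g\<in>G. b g \<in> D" unfolding span_over_def by blast
  then show "x + y \<in> span_over D G"
    unfolding span_over_def
    by (intro CollectI exI[of _ "\<lambda>g. a g + b g"])
       (auto simp: subring_setD[OF assms] algebra_simps sum.distrib)
next
  fix r x assume "r \<in> D" "x \<in> span_over D G"
  then obtain a where "x = (\<Sum>g\<in>G. a g * g)" "\<forall>g\<in>G. a g \<in> D" unfolding span_over_def by blast
  then show "r * x \<in> span_over D G"
    unfolding span_over_def using \<open>r \<in> D\<close>
    by (intro CollectI exI[of _ "\<lambda>g. r * a g"])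
       (auto simp: subring_setD[OF assms] algebra_simps sum_distrib_left)
qed

lemma span_over_base:
  assumes "subring_set D" "finite G" "g \<in> G"
  shows "g \<in> span_over D G"
  unfolding span_over_def using assms
  by (intro CollectI exI[of _ "\<lambda>h. if h = g then 1 else 0"])
     (auto simp: subring_setD if_distrib[of "\<lambda>u. u * _"] cong: if_cong)

lemma span_over_minimal: "submodule_over D M \<Longrightarrow> G \<subseteq> M \<Longrightarrow> span_over D G \<subseteq> M"
  unfolding span_over_def by (auto intro!: submodule_over_sum submodule_overD(3)[of D M])

lemma span_over_mono:
  assumes "subring_set D" "finite H" "G \<subseteq> H"
  shows "span_over D G \<subseteq> span_over D H"
  using assms by (intro span_over_minimal submodule_over_span) (auto intro: span_over_base)

lemma span_over_insertE:
  assumes "x \<in> span_over D (insert g G)" "finite G" "g \<notin> G"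
  obtains r m where "r \<in> D" "m \<in> span_over D G" "x = r * g + m"
proof -
  obtain c where c: "x = (\<Sum>h\<in>insert g G. c h * h)" "\<forall>h\<in>insert g G. c h \<in> D"
    using assms(1) unfolding span_over_def by blast
  show thesis
    using c assms by (intro that[of "c g" "\<Sum>h\<in>G. c h * h"]) (auto simp: span_over_def)
qed

lemma noetherian_setE:
  assumes "noetherian_set D" "submodule_over D N" "N \<subseteq> D"
  obtains G where "finite G" "G \<subseteq> N" "N \<subseteq> span_over D G"
  using assms unfolding noetherian_set_def by meson

text \<open>One generator \<open>g\<close> is split off: the coefficients of \<open>g\<close> in
  members of \<open>N\<close> form an ideal \<open>J\<close>, which is finitely generated. Once they
  are cancelled, what remains lies in \<open>N\<close> and in the span of \<open>G\<close>, where
  the induction hypothesis applies.\<close>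

lemma noetherian_submodule_fin_gen:
  assumes D: "subring_set D" "noetherian_set D"
    and "finite G" "submodule_over D N" "N \<subseteq> span_over D G"
  shows "\<exists>H. finite H \<and> H \<subseteq> N \<and> N \<subseteq> span_over D H"
  using assms(3-5)
proof (induction G arbitrary: N rule: finite_induct)
  case empty
  then show ?case by (intro exI[of _ "{}"]) auto
next
  case (insert g G)
  note spanG = submodule_over_span[OF D(1), of G]
  define J where "J = {r \<in> D. \<exists>m\<in>span_over D G. r * g + m \<in> N}"
  have "submodule_over D J"
    unfolding submodule_over_def
  proof (intro conjI ballI)
    show "0 \<in> J" unfolding J_def
      using subring_setD(1)[OF D(1)] submodule_overD(1)[OF spanG] submodule_overD(1)[OF insert.prems(1)]
      by (auto intro!: bexI[of _ 0])
  next
    fix x y assume "x \<in> J" "y \<in> J"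
    then obtain a b where ab: "x \<in> D" "y \<in> D" "a \<in> span_over D G" "b \<in> span_over D G"
      "x * g + a \<in> N" "y * g + b \<in> N" unfolding J_def by blast
    have "(x + y) * g + (a + b) = (x * g + a) + (y * g + b)" by (simp add: algebra_simps)
    then have "(x + y) * g + (a + b) \<in> N" using ab submodule_overD(2)[OF insert.prems(1)] by metis
    then show "x + y \<in> J" unfolding J_def
      using ab subring_setD(4)[OF D(1)] submodule_overD(2)[OF spanG] by blast
  next
    fix r x assume "r \<in> D" "x \<in> J"
    then obtain a where a: "x \<in> D" "a \<in> span_over D G" "x * g + a \<in> N" unfolding J_def by blast
    have "(r * x) * g + r * a = r * (x * g + a)" by (simp add: algebra_simps)
    then have "(r * x) * g + r * a \<in> N" using a \<open>r \<in> D\<close> submodule_overD(3)[OF insert.prems(1)] by metis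
    then show "r * x \<in> J" unfolding J_def
      using a \<open>r \<in> D\<close> subring_setD(6)[OF D(1)] submodule_overD(3)[OF spanG] by blast
  qed
  moreover have "J \<subseteq> D" unfolding J_def by blast
  ultimately obtain B where B: "finite B" "B \<subseteq> J" "J \<subseteq> span_over D B"
    using noetherian_setE[OF D(2)] by metis
  have "\<forall>b\<in>B. \<exists>m\<in>span_over D G. b * g + m \<in> N" using B(2) unfolding J_def by blast
  then obtain m where m: "\<And>b. b \<in> B \<Longrightarrow> m b \<in> span_over D G" "\<And>b. b \<in> B \<Longrightarrow> b * g + m b \<in> N"
    by metis
  have "submodule_over D (N \<inter> span_over D G)"
    using insert.prems(1) spanG unfolding submodule_over_def by blast
  then obtain H0 where H0: "finite H0" "H0 \<subseteq> N \<inter> span_over D G" "N \<inter> span_over D G \<subseteq> span_over D H0"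
    using insert.IH[of "N \<inter> span_over D G"] by blast
  define H where "H = (\<lambda>b. b * g + m b) ` B \<union> H0"
  have H: "finite H" "H \<subseteq> N" unfolding H_def using B H0 m by auto
  note spanH = submodule_over_span[OF D(1), of H]
  have "n \<in> span_over D H" if n: "n \<in> N" for n
  proof -
    obtain r k where rk: "r \<in> D" "k \<in> span_over D G" "n = r * g + k"
      using span_over_insertE[OF subsetD[OF insert.prems(2) n] insert.hyps(1,2)] by metis
    then have "r \<in> span_over D B" using B(3) n insert.prems unfolding J_def by blast
    then obtain c where c: "r = (\<Sum>b\<in>B. c b * b)" "\<forall>b\<in>B. c b \<in> D" unfolding span_over_def by blast
    define s where "s = (\<Sum>b\<in>B. c b * (b * g + m b))"
    have s: "s \<in> span_over D H" unfolding s_def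
      by (intro submodule_over_sum[OF spanH] submodule_overD(3)[OF spanH] span_over_base[OF D(1) H(1)])
         (use c in \<open>auto simp: H_def\<close>)
    then have "s \<in> N" using span_over_minimal[OF insert.prems(1) H(2)] by blast
    have "s = r * g + (\<Sum>b\<in>B. c b * m b)"
      unfolding s_def c(1) by (simp add: sum.distrib algebra_simps sum_distrib_left)
    then have "n - s = k - (\<Sum>b\<in>B. c b * m b)" using rk by simp
    moreover have "(\<Sum>b\<in>B. c b * m b) \<in> span_over D G"
      using c m by (intro submodule_over_sum[OF spanG] submodule_overD(3)[OF spanG]) auto
    ultimately have "n - s \<in> N \<inter> span_over D G"
      using submodule_over_diff[OF D(1) spanG rk(2)] submodule_over_diff[OF D(1) insert.prems(1) n \<open>s \<in> N\<close>]
      by (metis IntI)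
    then have "n - s \<in> span_over D H"
      using H0(3) span_over_mono[OF D(1) H(1), of H0] unfolding H_def by blast
    then show ?thesis using submodule_overD(2)[OF spanH _ s, of "n - s"] by simp
  qed
  then show ?case using H by blast
qed

lemma noetherian_set_finite_extension:
  assumes D: "subring_set D" "noetherian_set D" and "finite G" "T = span_over D G" "D \<subseteq> T"
  shows "noetherian_set T"
  unfolding noetherian_set_def
proof (intro allI impI)
  fix N assume N: "submodule_over T N \<and> N \<subseteq> T"
  obtain H where H: "finite H" "H \<subseteq> N" "N \<subseteq> span_over D H"
    using noetherian_submodule_fin_gen[OF D \<open>finite G\<close>, of N] N submodule_over_mono assms by blast
  moreover have "span_over D H \<subseteq> span_over T H" using \<open>D \<subseteq> T\<close> unfolding span_over_def by blast
  ultimately show "\<exists>G. finite G \<and> G \<subseteq> N \<and> N \<subseteq> span_over T G" by blast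
qed

section \<open>Integral elements and the integral closure\<close>

definition integral_over :: "'k::field set \<Rightarrow> 'k \<Rightarrow> bool"
  where "integral_over D x \<longleftrightarrow> (\<exists>p. lead_coeff p = 1 \<and> (\<forall>i. coeff p i \<in> D) \<and> poly p x = 0)"

text \<open>
  The multiples \<open>d * p(x)\<close> form a finitely generated \<open>D\<close>-module; a monomial \<open>x ^ n\<close> beyond the degrees
  of its generators then satisfies a monic equation.
\<close>

lemma integral_overI_noetherian:
  fixes D :: "'k::field set"
  assumes D: "subring_set D" "noetherian_set D" and "finite G" "d \<noteq> 0"
    and pow: "\<And>n. d * x ^ n \<in> span_over D G"
  shows "integral_over D x"
proof -
  note spanG = submodule_over_span[OF D(1), of G]
  define N where "N = {d * poly p x | p. \<forall>i. coeff p i \<in> D}"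
  have "submodule_over D N"
    unfolding submodule_over_def
  proof (intro conjI ballI)
    show "0 \<in> N" unfolding N_def
      using subring_setD(1)[OF D(1)] by (auto intro!: exI[of _ 0])
  next
    fix a b assume "a \<in> N" "b \<in> N"
    then obtain p q where "a = d * poly p x" "b = d * poly q x" "\<forall>i. coeff p i \<in> D" "\<forall>i. coeff q i \<in> D"
      unfolding N_def by blast
    then show "a + b \<in> N" unfolding N_def
      by (intro CollectI exI[of _ "p + q"]) (auto simp: algebra_simps subring_setD[OF D(1)])
  next
    fix r a assume "r \<in> D" "a \<in> N"
    then obtain p where "a = d * poly p x" "\<forall>i. coeff p i \<in> D"
      unfolding N_def by blast
    then show "r * a \<in> N" unfolding N_def using \<open>r \<in> D\<close>
      by (intro CollectI exI[of _ "smult r p"]) (auto simp: algebra_simps subring_setD[OF D(1)])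
  qed
  moreover have "N \<subseteq> span_over D G"
  proof
    fix a assume "a \<in> N"
    then obtain p where p: "a = d * poly p x" "\<forall>i. coeff p i \<in> D"
      unfolding N_def by blast
    have "a = (\<Sum>i\<le>degree p. coeff p i * (d * x ^ i))"
      unfolding p poly_altdef by (simp add: sum_distrib_left algebra_simps)
    then show "a \<in> span_over D G"
      using p(2) pow by (metis (no_types, lifting) submodule_over_sum[OF spanG] submodule_overD(3)[OF spanG])
  qed
  ultimately obtain H where H: "finite H" "H \<subseteq> N" "N \<subseteq> span_over D H"
    using noetherian_submodule_fin_gen[OF D \<open>finite G\<close>, of N] by blast
  have "\<forall>h\<in>H. \<exists>p. d * poly p x = h \<and> (\<forall>i. coeff p i \<in> D)" using H(2) unfolding N_def by blast
  then obtain p where p: "\<And>h. h \<in> H \<Longrightarrow> d * poly (p h) x = h" "\<And>h i. h \<in> H \<Longrightarrow> coeff (p h) i \<in> D"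
    by metis
  define n where "n = Suc (\<Sum>h\<in>H. degree (p h))"
  have deg: "degree (p h) < n" if "h \<in> H" for h
    unfolding n_def using member_le_sum[of h H "\<lambda>h. degree (p h)"] H(1) that by simp
  have "d * x ^ n \<in> N" unfolding N_def
    by (intro CollectI exI[of _ "monom 1 n"]) (auto simp: poly_monom subring_setD[OF D(1)])
  then obtain c where c: "d * x ^ n = (\<Sum>h\<in>H. c h * h)" "\<forall>h\<in>H. c h \<in> D"
    using H(3) unfolding span_over_def by blast
  define s where "s = (\<Sum>h\<in>H. smult (c h) (p h))"
  have "coeff s i = 0" if "i \<ge> n" for i
    unfolding s_def coeff_sum using less_le_trans[OF deg that]
    by (intro sum.neutral ballI) (simp add: coeff_eq_0)
  then have "coeff (monom 1 n - s) i = 0" if "i > n" for i using that by simp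
  then have "degree (monom 1 n - s) \<le> n" by (intro degree_le) auto
  moreover have c1: "coeff (monom 1 n - s) n = 1" using \<open>\<And>i. i \<ge> n \<Longrightarrow> coeff s i = 0\<close> by simp
  ultimately have "degree (monom 1 n - s) = n"
    by (metis le_degree le_antisym zero_neq_one)
  moreover have "coeff (monom 1 n - s) i \<in> D" for i
    unfolding s_def using c p by (auto simp: coeff_sum intro!: subring_setD[OF D(1)] subring_set_sum[OF D(1)])
  moreover have "d * poly s x = (\<Sum>h\<in>H. c h * h)"
    unfolding s_def poly_sum sum_distrib_left
  proof (intro sum.cong refl)
    fix h assume "h \<in> H"
    show "d * poly (smult (c h) (p h)) x = c h * h"
      using p(1)[OF \<open>h \<in> H\<close>] by (simp add: algebra_simps)
  qed
  then have "poly (monom 1 n - s) x = 0" using c(1) \<open>d \<noteq> 0\<close>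
    by (metis mult_left_cancel poly_diff poly_monom mult_1 right_minus_eq)
  ultimately show ?thesis unfolding integral_over_def using c1
    by (intro exI[of _ "monom 1 n - s"]) auto
qed

lemma integral_over_powers_fin_gen:
  assumes D: "subring_set D" and "integral_over D x"
  obtains G where "finite G" "\<And>n. x ^ n \<in> span_over D G"
proof -
  obtain p where p: "lead_coeff p = 1" "\<And>i. coeff p i \<in> D" "poly p x = 0"
    using assms(2) unfolding integral_over_def by blast
  define G where "G = (\<lambda>i. x ^ i) ` {..<degree p}"
  note spanG = submodule_over_span[OF D(1), of G]
  have "x ^ n \<in> span_over D G" for n
  proof (induction n rule: less_induct)
    case (less n)
    show ?case
    proof (cases "n < degree p")
      case True
      then show ?thesis by (intro span_over_base[OF D]) (auto simp: G_def)
    next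
      case False
      have "0 = poly p x * x ^ (n - degree p)" using p by simp
      also have "\<dots> = (\<Sum>i\<le>degree p. coeff p i * x ^ (i + (n - degree p)))"
        unfolding poly_altdef by (simp add: sum_distrib_right power_add mult.assoc)
      also have "\<dots> = (\<Sum>i<degree p. coeff p i * x ^ (i + (n - degree p))) + x ^ n"
        using False p(1) by (simp flip: lessThan_Suc_atMost)
      finally have "x ^ n = - (\<Sum>i<degree p. coeff p i * x ^ (i + (n - degree p)))"
        by (metis add.inverse_inverse add_eq_0_iff)
      moreover have "(\<Sum>i<degree p. coeff p i * x ^ (i + (n - degree p))) \<in> span_over D G"
        using False p(2)
        by (intro submodule_over_sum[OF spanG] submodule_overD(3)[OF spanG] less) auto
      ultimately show ?thesis using submodule_over_uminus[OF D spanG] by simp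
    qed
  qed
  then show thesis by (intro that[of G]) (auto simp: G_def)
qed

lemma span_over_mult:
  assumes D: "subring_set D" and "finite G" "finite H" "x \<in> span_over D G" "y \<in> span_over D H"
  shows "x * y \<in> span_over D ((\<lambda>(g, h). g * h) ` (G \<times> H))"
proof -
  define K where "K = (\<lambda>(g, h). g * h) ` (G \<times> H)"
  have K: "finite K" unfolding K_def using assms by auto
  note spanK = submodule_over_span[OF D, of K]
  obtain a b where ab: "x = (\<Sum>g\<in>G. a g * g)" "y = (\<Sum>h\<in>H. b h * h)" "\<forall>g\<in>G. a g \<in> D" "\<forall>h\<in>H. b h \<in> D"
    using assms(4,5) unfolding span_over_def by blast
  have "x * y = (\<Sum>g\<in>G. \<Sum>h\<in>H. (a g * b h) * (g * h))"
    unfolding ab sum_product by (simp add: algebra_simps)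
  also have "\<dots> \<in> span_over D K"
    using ab(3,4)
    by (intro submodule_over_sum[OF spanK] submodule_overD(3)[OF spanK] span_over_base[OF D K])
       (auto simp: K_def subring_setD[OF D])
  finally show ?thesis unfolding K_def .
qed

text \<open>Products of generators for the powers of \<open>x\<close> and of \<open>y\<close> span a
  finite module containing every \<open>(x * y) ^ n\<close>; the common denominator is 1
  here.\<close>

lemma integral_over_mult:
  assumes D: "subring_set D" "noetherian_set D" and "integral_over D x" "integral_over D y"
  shows "integral_over D (x * y)"
proof -
  obtain G where G: "finite G" "\<And>n. x ^ n \<in> span_over D G"
    using integral_over_powers_fin_gen[OF D(1) assms(3)] by blast
  obtain H where H: "finite H" "\<And>n. y ^ n \<in> span_over D H"
    using integral_over_powers_fin_gen[OF D(1) assms(4)] by blast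
  show ?thesis
    using G H
    by (intro integral_overI_noetherian[OF D, of "(\<lambda>(g, h). g * h) ` (G \<times> H)" 1])
       (auto simp: power_mult_distrib intro!: span_over_mult[OF D(1)])
qed

lemma frac_field_memI: "a \<in> D \<Longrightarrow> b \<in> D \<Longrightarrow> b \<noteq> 0 \<Longrightarrow> a / b \<in> frac_field D"
  unfolding frac_field_def by blast

lemma frac_field_memE:
  assumes "x \<in> frac_field D" 
  obtains a b where "a \<in> D" "b \<in> D" "b \<noteq> 0" "x = a / b"
  using assms unfolding frac_field_def by blast

lemma frac_field_mult:
  assumes "subring_set D" "x \<in> frac_field D" "y \<in> frac_field D"
  shows "x * y \<in> frac_field D"
  by (rule frac_field_memE[OF assms(2)], rule frac_field_memE[OF assms(3)])
     (auto intro!: frac_field_memI simp: subring_setD[OF assms(1)])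

lemma frac_field_divide:
  assumes "subring_set D" "x \<in> frac_field D" "y \<in> frac_field D"
  shows "x / y \<in> frac_field D"
proof (cases "y = 0")
  case True
  then show ?thesis using frac_field_memI[of 0 D 1] subring_setD[OF assms(1)] by simp
next
  case False
  then show ?thesis
  by (rule_tac frac_field_memE[OF assms(2)], rule_tac frac_field_memE[OF assms(3)])
     (auto intro!: frac_field_memI simp: subring_setD[OF assms(1)])
qed

lemma integral_closure_eq: "integral_closure D = {x \<in> frac_field D. integral_over D x}"
  unfolding integral_closure_def integral_over_def ..

lemma subset_integral_closure:
  assumes "subring_set D" shows "D \<subseteq> integral_closure D"
proof
  fix x assume x: "x \<in> D"
  have "coeff [:- x, 1:] i \<in> D" for i
    using x by (auto simp: coeff_pCons subring_setD[OF assms] split: nat.splits)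
  then have "integral_over D x"
    unfolding integral_over_def by (intro exI[of _ "[:- x, 1:]"]) auto
  moreover have "x \<in> frac_field D" using frac_field_memI[of x D 1] x subring_setD[OF assms] by simp
  ultimately show "x \<in> integral_closure D" unfolding integral_closure_eq by blast
qed

text \<open>Being a span over \<open>D\<close>, the closure has differences for free, so only
  products need integrality. All \<open>d * z ^ n\<close> lie in this one finitely generated module,
  which makes an almost integral \<open>z\<close> integral.\<close>

lemma finite_integral_closure:
  assumes D: "subring_set D" "noetherian_set D" and "fin_gen_module D (integral_closure D)"
  shows "subring_set (integral_closure D)" "noetherian_set (integral_closure D)"
    "completely_integrally_closed (integral_closure D)"
proof -
  obtain G where G: "finite G" "integral_closure D = span_over D G"
    using assms(3) unfolding fin_gen_module_def span_over_def by blast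
  note spanG = submodule_over_span[OF D(1), of G]
  note sub = subset_integral_closure[OF D(1)]
  show "noetherian_set (integral_closure D)"
    using noetherian_set_finite_extension[OF D G sub] .
  show "subring_set (integral_closure D)"
    unfolding subring_set_def
  proof (intro conjI ballI)
    show "1 \<in> integral_closure D" using sub subring_setD(2)[OF D(1)] by blast
  next
    fix x y assume xy: "x \<in> integral_closure D" "y \<in> integral_closure D"
    show "x - y \<in> integral_closure D"
      using xy submodule_over_diff[OF D(1) spanG] unfolding G(2) by blast
    show "x * y \<in> integral_closure D"
      using xy integral_over_mult[OF D] frac_field_mult[OF D(1)] unfolding integral_closure_eq by blast
  qed
  show "completely_integrally_closed (integral_closure D)"
    unfolding completely_integrally_closed_def
  proof (intro allI impI)
    fix z d assume *: "d \<in> integral_closure D \<and> d \<noteq> 0 \<and> (\<forall>n. d * z ^ n \<in> integral_closure D)"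
    then have "integral_over D z"
      by (intro integral_overI_noetherian[OF D G(1), of d]) (auto simp: G(2))
    moreover have "z = (d * z ^ 1) / d" using * by simp
    then have "z \<in> frac_field D"
      using * frac_field_divide[OF D(1), of "d * z ^ 1" d] unfolding integral_closure_eq
      by (metis (no_types, lifting) mem_Collect_eq)
    ultimately show "z \<in> integral_closure D" unfolding integral_closure_eq by blast
  qed
qed

section \<open>Polynomials and power series over a subring\<close>

definition ring_map :: "('a::comm_ring_1 \<Rightarrow> 'b::comm_ring_1) \<Rightarrow> bool"
  where "ring_map h \<longleftrightarrow> h 1 = 1 \<and> (\<forall>x y. h (x + y) = h x + h y \<and> h (x * y) = h x * h y)"

lemma ring_mapD:
  assumes "ring_map h"
  shows "h 0 = 0" "h 1 = 1" "h (x + y) = h x + h y" "h (x * y) = h x * h y" "h (- x) = - h x"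
    "h (x - y) = h x - h y" "h (sum f A) = (\<Sum>i\<in>A. h (f i))"
proof -
  have *: "h 1 = 1" "\<And>x y. h (x + y) = h x + h y" "\<And>x y. h (x * y) = h x * h y"
    using assms by (auto simp: ring_map_def)
  have 0: "h 0 = 0" using *(2)[of 0 0] by simp
  have m: "h (- x) = - h x" for x using *(2)[of x "- x"] 0 by (simp add: eq_neg_iff_add_eq_0 add.commute)
  show "h 0 = 0" "h 1 = 1" "h (x + y) = h x + h y" "h (x * y) = h x * h y" "h (- x) = - h x"
    "h (x - y) = h x - h y"
    using * 0 m *(2)[of x "- y"] by auto
  show "h (sum f A) = (\<Sum>i\<in>A. h (f i))"
    by (induction A rule: infinite_finite_induct) (auto simp: * 0)
qed

lemma subring_set_image:
  assumes "ring_map h" "subring_set D"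
  shows "subring_set (h ` D)"
  unfolding subring_set_def
proof (intro conjI ballI)
  show "1 \<in> h ` D" using ring_mapD(2)[OF assms(1)] subring_setD(2)[OF assms(2)] by (metis imageI)
next
  fix x y assume "x \<in> h ` D" "y \<in> h ` D"
  then obtain a b where "x = h a" "y = h b" "a \<in> D" "b \<in> D" by blast
  then show "x - y \<in> h ` D" "x * y \<in> h ` D"
    using subring_setD(5,6)[OF assms(2)] by (auto simp flip: ring_mapD[OF assms(1)])
qed

text \<open>Ideals pull back along \<open>h\<close> and their generators push forward. It serves for
  the copy of \<open>S\<close> formed by the constants and for the copy of \<open>T\<close> in a
  fraction field.\<close>

lemma noetherian_set_image:
  assumes h: "ring_map h" and D: "subring_set D" "noetherian_set D"
  shows "noetherian_set (h ` D)"
  unfolding noetherian_set_def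
proof (intro allI impI, elim conjE)
  fix N assume N: "submodule_over (h ` D) N" "N \<subseteq> h ` D"
  define N' where "N' = {x \<in> D. h x \<in> N}"
  have "submodule_over D N'"
    unfolding submodule_over_def N'_def
    using submodule_overD[OF N(1)] subring_setD[OF D(1)] ring_mapD[OF h] by auto
  moreover have "N' \<subseteq> D" unfolding N'_def by blast
  ultimately obtain G where G: "finite G" "G \<subseteq> N'" "N' \<subseteq> span_over D G"
    using noetherian_setE[OF D(2)] by metis
  note hD = subring_set_image[OF h D(1)]
  note spanG = submodule_over_span[OF hD, of "h ` G"]
  have "n \<in> span_over (h ` D) (h ` G)" if n: "n \<in> N" for n
  proof -
    obtain x where x: "x \<in> N'" "n = h x" using n N(2) unfolding N'_def by blast
    then obtain c where c: "x = (\<Sum>g\<in>G. c g * g)" "\<forall>g\<in>G. c g \<in> D"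
      using G(3) unfolding span_over_def by blast
    have "n = (\<Sum>g\<in>G. h (c g) * h g)" unfolding x(2) c(1) by (simp add: ring_mapD(4,7)[OF h])
    then show ?thesis
      using c(2) G(1)
      by (simp only:)
        (intro submodule_over_sum[OF spanG] submodule_overD(3)[OF spanG] span_over_base[OF hD]; blast)
  qed
  moreover have "h ` G \<subseteq> N" using G(2) unfolding N'_def by blast
  ultimately show "\<exists>G. finite G \<and> G \<subseteq> N \<and> N \<subseteq> span_over (h ` D) G"
    using G(1) by (intro exI[of _ "h ` G"]) auto
qed

section \<open>Hilbert's basis theorem for polynomials and power series\<close>

definition poly_over :: "'a::comm_ring_1 set \<Rightarrow> 'a poly set"
  where "poly_over S = {p. \<forall>i. coeff p i \<in> S}"

definition fps_over :: "'a::comm_ring_1 set \<Rightarrow> 'a fps set"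
  where "fps_over S = {f. \<forall>i. fps_nth f i \<in> S}"

lemma subring_set_poly_over:
  assumes S: "subring_set S" shows "subring_set (poly_over S)"
  unfolding subring_set_def poly_over_def
  by (auto simp: coeff_mult subring_setD[OF S] intro!: subring_set_sum[OF S])

lemma subring_set_fps_over:
  assumes S: "subring_set S" shows "subring_set (fps_over S)"
  unfolding subring_set_def fps_over_def
  by (auto simp: fps_mult_nth subring_setD[OF S] intro!: subring_set_sum[OF S])

lemma ring_map_const_poly: "ring_map (\<lambda>s::'a::comm_ring_1. [:s:])"
  by (auto simp: ring_map_def one_pCons)

lemma ring_map_fps_const: "ring_map (fps_const :: 'a::comm_ring_1 \<Rightarrow> _)"
  by (auto simp: ring_map_def)

text \<open>Finitely many members of \<open>N\<close>, shifted to one common degree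
  \<open>d\<close>, have leading coefficients generating the ideal \<open>J\<close> of all leading
  coefficients. They reduce everything of degree at least \<open>d\<close>; the rest lies in a
  finite module over the constants.\<close>

lemma noetherian_poly_over:
  fixes S :: "'a::comm_ring_1 set"
  assumes S: "subring_set S" "noetherian_set S"
  shows "noetherian_set (poly_over S)"
  unfolding noetherian_set_def
proof (intro allI impI, elim conjE)
  fix N assume N: "submodule_over (poly_over S) N" "N \<subseteq> poly_over S"
  note T = subring_set_poly_over[OF S(1)]
  have monom_T: "monom s n \<in> poly_over S" if "s \<in> S" for s n
    using that subring_setD(1)[OF S(1)] unfolding poly_over_def by simp
  have const_T: "[:s:] \<in> poly_over S" if "s \<in> S" for s
    using monom_T[OF that, of 0] by (simp add: monom_0)
  have shift: "\<exists>g\<in>N. (\<forall>i>n + k. coeff g i = 0) \<and> coeff g (n + k) = coeff f n"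
    if "f \<in> N" "\<forall>i>n. coeff f i = 0" for f n k
    using that monom_T[OF subring_setD(2)[OF S(1)], of k]
    by (intro bexI[of _ "monom 1 k * f"] submodule_overD(3)[OF N(1)]) (auto simp: coeff_monom_mult)
  \<comment> \<open>Here \<open>n\<close> is only a bound above which nothing occurs, not the
    degree. The coefficient at \<open>n\<close> may vanish, so 0 and sums with cancelling top terms
    need no separate treatment.\<close>
  define J where "J = {s. \<exists>f\<in>N. \<exists>n. (\<forall>i>n. coeff f i = 0) \<and> coeff f n = s}"
  have "submodule_over S J"
    unfolding submodule_over_def
  proof (intro conjI ballI)
    show "0 \<in> J" unfolding J_def using submodule_overD(1)[OF N(1)] by (auto intro!: bexI[of _ 0])
  next
    fix x y assume "x \<in> J" "y \<in> J"
    then obtain f n g m where *: "f \<in> N" "\<forall>i>n. coeff f i = 0" "coeff f n = x"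
      "g \<in> N" "\<forall>i>m. coeff g i = 0" "coeff g m = y" unfolding J_def by blast
    obtain f' where f': "f' \<in> N" "\<forall>i>n + m. coeff f' i = 0" "coeff f' (n + m) = x"
      using shift[OF *(1,2), of m] *(3) by blast
    obtain g' where g': "g' \<in> N" "\<forall>i>n + m. coeff g' i = 0" "coeff g' (n + m) = y"
      using shift[OF *(4,5), of n] *(6) by (metis add.commute)
    show "x + y \<in> J" unfolding J_def using f' g' submodule_overD(2)[OF N(1) f'(1) g'(1)]
      by (auto intro!: bexI[of _ "f' + g'"] exI[of _ "n + m"])
  next
    fix r x assume "r \<in> S" "x \<in> J"
    then obtain f n where *: "f \<in> N" "\<forall>i>n. coeff f i = 0" "coeff f n = x" unfolding J_def by blast
    then show "r * x \<in> J" unfolding J_def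
      using submodule_overD(3)[OF N(1) const_T[OF \<open>r \<in> S\<close>] *(1)]
      by (auto intro!: bexI[of _ "[:r:] * f"] exI[of _ n])
  qed
  moreover have "J \<subseteq> S" using N(2) unfolding J_def poly_over_def by blast
  ultimately obtain B where B: "finite B" "B \<subseteq> J" "J \<subseteq> span_over S B"
    using noetherian_setE[OF S(2)] by metis
  have "\<forall>b\<in>B. \<exists>f n. f \<in> N \<and> (\<forall>i>n. coeff f i = 0) \<and> coeff f n = b"
    using B(2) unfolding J_def by blast
  then obtain F0 n where F0: "\<And>b. b \<in> B \<Longrightarrow> F0 b \<in> N" "\<And>b. b \<in> B \<Longrightarrow> \<forall>i>n b. coeff (F0 b) i = 0"
    "\<And>b. b \<in> B \<Longrightarrow> coeff (F0 b) (n b) = b" by metis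
  \<comment> \<open>Any common upper bound of the \<open>n b\<close> would do; the sum also makes
    sense for empty \<open>B\<close>.\<close>
  define d where "d = sum n B"
  have "\<forall>b\<in>B. \<exists>f. f \<in> N \<and> (\<forall>i>d. coeff f i = 0) \<and> coeff f d = b"
  proof
    fix b assume b: "b \<in> B"
    have "n b + (d - n b) = d" using member_le_sum[of b B n] B(1) b unfolding d_def by simp
    then show "\<exists>f. f \<in> N \<and> (\<forall>i>d. coeff f i = 0) \<and> coeff f d = b"
      using shift[OF F0(1,2)[OF b], of "d - n b"] F0(3)[OF b] by auto
  qed
  then obtain F where F: "\<And>b. b \<in> B \<Longrightarrow> F b \<in> N" "\<And>b i. b \<in> B \<Longrightarrow> i > d \<Longrightarrow> coeff (F b) i = 0"
    "\<And>b. b \<in> B \<Longrightarrow> coeff (F b) d = b" by metis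
  \<comment> \<open>The part of \<open>N\<close> below degree \<open>d\<close> is not stable under
    \<open>poly_over S\<close>, but it is a module over the constants, inside the span of finitely
    many monomials.\<close>
  define S' where "S' = (\<lambda>s. [:s:]) ` S"
  have S': "subring_set S'" "noetherian_set S'" "S' \<subseteq> poly_over S"
    unfolding S'_def using ring_map_const_poly S const_T
    by (auto intro!: subring_set_image noetherian_set_image)
  define M where "M = {f \<in> N. \<forall>i\<ge>d. coeff f i = 0}"
  define Y :: "'a poly set" where "Y = monom 1 ` {..<d}"
  note spanY = submodule_over_span[OF S'(1), of Y]
  have "submodule_over S' M"
    using submodule_over_mono[OF N(1) S'(3)] unfolding M_def submodule_over_def
    by (auto simp: S'_def)
  moreover have "f \<in> span_over S' Y" if f: "f \<in> M" for f
  proof -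
    have "f = (\<Sum>i<d. [:coeff f i:] * monom 1 i)"
    proof (rule poly_eqI)
      fix j
      show "coeff f j = coeff (\<Sum>i<d. [:coeff f i:] * monom 1 i) j"
        using f by (auto simp: coeff_sum M_def if_distrib[of "\<lambda>u. _ * u"] cong: if_cong)
    qed
    moreover have "(\<Sum>i<d. [:coeff f i:] * monom 1 i) \<in> span_over S' Y"
      using f N(2)
      by (intro submodule_over_sum[OF spanY] submodule_overD(3)[OF spanY] span_over_base[OF S'(1)])
         (auto simp: Y_def S'_def M_def poly_over_def)
    ultimately show ?thesis by metis
  qed
  then have "M \<subseteq> span_over S' Y" by blast
  moreover have "finite Y" unfolding Y_def by simp
  ultimately obtain H where H: "finite H" "H \<subseteq> M" "M \<subseteq> span_over S' H"
    using noetherian_submodule_fin_gen[OF S'(1,2)] by metis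
  define G where "G = F ` B \<union> H"
  have G: "finite G" "G \<subseteq> N" unfolding G_def using B H F(1) by (auto simp: M_def)
  note spanG = submodule_over_span[OF T, of G]
  have "M \<subseteq> span_over (poly_over S) G"
    using H(3) span_over_minimal[OF submodule_over_mono[OF spanG S'(3)], of H] span_over_base[OF T G(1)]
    unfolding G_def by blast
  have "f \<in> span_over (poly_over S) G" if "f \<in> N" "\<forall>i\<ge>n. coeff f i = 0" for f n
    using that
  proof (induction n arbitrary: f)
    case 0
    then have "f = 0" by (auto intro: poly_eqI)
    then show ?case using submodule_overD(1)[OF spanG] by simp
  next
    case (Suc n)
    show ?case
    proof (cases "Suc n \<le> d")
      case True
      then have "f \<in> M" unfolding M_def using Suc.prems by auto
      then show ?thesis using \<open>M \<subseteq> span_over (poly_over S) G\<close> by blast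
    next
      case False
      have "coeff f n \<in> J" unfolding J_def using Suc.prems by (auto simp: Suc_le_eq)
      then obtain c where c: "coeff f n = (\<Sum>b\<in>B. c b * b)" "\<forall>b\<in>B. c b \<in> S"
        using B(3) unfolding span_over_def by blast
      define s where "s = (\<Sum>b\<in>B. monom (c b) (n - d) * F b)"
      have s: "s \<in> span_over (poly_over S) G" unfolding s_def using c(2)
        by (intro submodule_over_sum[OF spanG] submodule_overD(3)[OF spanG] span_over_base[OF T G(1)] monom_T)
           (auto simp: G_def)
      then have "s \<in> N" using span_over_minimal[OF N(1) G(2)] by blast
      have "coeff s n = coeff f n"
        unfolding s_def c(1) using False F(3) by (auto simp: coeff_sum coeff_monom_mult intro!: sum.cong)
      moreover have "coeff s i = 0" if "i > n" for i
        unfolding s_def using False F(2) that by (auto simp: coeff_sum coeff_monom_mult intro!: sum.neutral)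
      ultimately have "\<forall>i\<ge>n. coeff (f - s) i = 0" using Suc.prems(2)
        by (metis coeff_diff diff_self le_neq_implies_less Suc_leI)
      then have "f - s \<in> span_over (poly_over S) G"
        using Suc.IH submodule_over_diff[OF T N(1) Suc.prems(1) \<open>s \<in> N\<close>] by blast
      then show ?thesis using submodule_overD(2)[OF spanG _ s, of "f - s"] by simp
    qed
  qed
  then have "N \<subseteq> span_over (poly_over S) G" by (meson coeff_eq_0 less_le_trans lessI subsetI)
  then show "\<exists>G. finite G \<and> G \<subseteq> N \<and> N \<subseteq> span_over (poly_over S) G" using G by blast
qed

text \<open>
  The coefficients with respect to the \<open>F b\<close> are found one at a time, by cancelling the lowest term of
  the remainder \<open>E n\<close>.
\<close>

lemma fps_adic_span:
  fixes S :: "'a::comm_ring_1 set"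
  assumes S: "subring_set S" and N: "submodule_over (fps_over S) N"
    and B: "finite B" and F: "\<And>b. b \<in> B \<Longrightarrow> F b \<in> N" "\<And>b i. b \<in> B \<Longrightarrow> i < d \<Longrightarrow> fps_nth (F b) i = 0"
      "\<And>b. b \<in> B \<Longrightarrow> fps_nth (F b) d = b"
    and lead: "\<And>f n. f \<in> N \<Longrightarrow> \<forall>i<n. fps_nth f i = 0 \<Longrightarrow> fps_nth f n \<in> span_over S B"
    and f: "f \<in> N" "\<forall>i<d. fps_nth f i = 0"
  shows "f \<in> span_over (fps_over S) (F ` B)"
proof -
  note T = subring_set_fps_over[OF S]
  have const_T: "fps_const s \<in> fps_over S" if "s \<in> S" for s
    using that subring_setD(1)[OF S] unfolding fps_over_def by simp
  have X_T: "fps_X ^ k \<in> fps_over S" for k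
    using subring_setD(1,2)[OF S] unfolding fps_over_def by simp
  have "\<forall>a\<in>span_over S B. \<exists>c. a = (\<Sum>b\<in>B. c b * b) \<and> (\<forall>b\<in>B. c b \<in> S)"
    unfolding span_over_def by blast
  then obtain C where C: "\<And>a. a \<in> span_over S B \<Longrightarrow> a = (\<Sum>b\<in>B. C a b * b)"
    "\<And>a b. a \<in> span_over S B \<Longrightarrow> b \<in> B \<Longrightarrow> C a b \<in> S" by metis
  define E where "E = rec_nat f (\<lambda>n g. g - (\<Sum>b\<in>B. fps_const (C (fps_nth g (d + n)) b) * fps_X ^ n * F b))"
  have E0: "E 0 = f" and ES: "E (Suc n) = E n - (\<Sum>b\<in>B. fps_const (C (fps_nth (E n) (d + n)) b) * fps_X ^ n * F b)" for n
    unfolding E_def by simp_all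
  have E: "E n \<in> N \<and> (\<forall>i<d + n. fps_nth (E n) i = 0)" for n
  proof (induction n)
    case 0
    then show ?case using f E0 by simp
  next
    case (Suc n)
    then have a: "fps_nth (E n) (d + n) \<in> span_over S B" using lead by blast
    have "(\<Sum>b\<in>B. fps_const (C (fps_nth (E n) (d + n)) b) * fps_X ^ n * F b) \<in> N"
      using C(2)[OF a] F(1)
      by (intro submodule_over_sum[OF N] submodule_overD(3)[OF N] subring_setD(6)[OF T] const_T X_T) auto
    then have "E (Suc n) \<in> N" unfolding ES using submodule_over_diff[OF T N] Suc by blast
    moreover have "fps_nth (E (Suc n)) i = 0" if "i < d + Suc n" for i
    proof (cases "i = d + n")
      case True
      have "fps_nth (\<Sum>b\<in>B. fps_const (C (fps_nth (E n) (d + n)) b) * fps_X ^ n * F b) i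
        = (\<Sum>b\<in>B. C (fps_nth (E n) (d + n)) b * b)"
        unfolding fps_sum_nth using True F(3)
        by (intro sum.cong) (auto simp: mult.assoc fps_X_power_mult_nth)
      then show ?thesis unfolding ES using C(1)[OF a] True by simp
    next
      case False
      have "fps_nth (\<Sum>b\<in>B. fps_const (C (fps_nth (E n) (d + n)) b) * fps_X ^ n * F b) i = 0"
        unfolding fps_sum_nth using False that F(2)
        by (intro sum.neutral) (auto simp: mult.assoc fps_X_power_mult_nth)
      then show ?thesis unfolding ES using Suc False that by simp
    qed
    ultimately show ?case by blast
  qed
  define g where "g b = Abs_fps (\<lambda>n. C (fps_nth (E n) (d + n)) b)" for b
  have g: "g b \<in> fps_over S" if "b \<in> B" for b
    using C(2) E lead that unfolding fps_over_def g_def by auto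
  have partial: "f - E n = (\<Sum>b\<in>B. fps_cutoff n (g b) * F b)" for n
  proof (induction n)
    case 0
    then show ?case by (simp add: E0)
  next
    case (Suc n)
    have "fps_cutoff (Suc n) (g b) = fps_cutoff n (g b) + fps_const (C (fps_nth (E n) (d + n)) b) * fps_X ^ n" for b
      by (rule fps_ext) (auto simp: g_def less_Suc_eq)
    then show ?case using Suc unfolding ES by (simp add: algebra_simps sum.distrib)
  qed
  have "f = (\<Sum>b\<in>B. g b * F b)"
  proof (rule fps_ext)
    fix j
    have "fps_nth f j = fps_nth (f - E (Suc j)) j" using E[of "Suc j"] by simp
    also have "\<dots> = (\<Sum>b\<in>B. fps_nth (fps_cutoff (Suc j) (g b) * F b) j)"
      unfolding partial fps_sum_nth ..
    also have "\<dots> = (\<Sum>b\<in>B. fps_nth (g b * F b) j)"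
      by (intro sum.cong refl) (auto simp: fps_mult_nth intro!: sum.cong)
    finally show "fps_nth f j = fps_nth (\<Sum>b\<in>B. g b * F b) j" by (simp add: fps_sum_nth)
  qed
  moreover have "(\<Sum>b\<in>B. g b * F b) \<in> span_over (fps_over S) (F ` B)"
    using submodule_over_span[OF T, of "F ` B"] g B
    by (intro submodule_over_sum submodule_overD(3) span_over_base[OF T]) auto
  ultimately show ?thesis by simp
qed

text \<open>Lowest coefficients replace leading ones. Low-order series have no finite description,
  so the submodule of low degree is replaced by the truncations \<open>M\<close> at
  \<open>d\<close>, whose generators are lifted back to \<open>N\<close> by \<open>k\<close>. After
  the first \<open>d\<close> coefficients are matched, the remainder has order at least
  \<open>d\<close> and \<open>fps_adic_span\<close> applies.\<close>

lemma noetherian_fps_over: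
  fixes S :: "'a::comm_ring_1 set"
  assumes S: "subring_set S" "noetherian_set S"
  shows "noetherian_set (fps_over S)"
  unfolding noetherian_set_def
proof (intro allI impI, elim conjE)
  fix N assume N: "submodule_over (fps_over S) N" "N \<subseteq> fps_over S"
  note T = subring_set_fps_over[OF S(1)]
  have const_T: "fps_const s \<in> fps_over S" if "s \<in> S" for s
    using that subring_setD(1)[OF S(1)] unfolding fps_over_def by simp
  have X_T: "fps_X ^ k \<in> fps_over S" for k
    using subring_setD(1,2)[OF S(1)] unfolding fps_over_def by simp
  have shift: "\<exists>g\<in>N. (\<forall>i<n + k. fps_nth g i = 0) \<and> fps_nth g (n + k) = fps_nth f n"
    if "f \<in> N" "\<forall>i<n. fps_nth f i = 0" for f n k
    using that X_T[of k]
    by (intro bexI[of _ "fps_X ^ k * f"] submodule_overD(3)[OF N(1)]) (auto simp: fps_X_power_mult_nth)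
  define J where "J = {s. \<exists>f\<in>N. \<exists>n. (\<forall>i<n. fps_nth f i = 0) \<and> fps_nth f n = s}"
  have "submodule_over S J"
    unfolding submodule_over_def
  proof (intro conjI ballI)
    show "0 \<in> J" unfolding J_def using submodule_overD(1)[OF N(1)] by (auto intro!: bexI[of _ 0])
  next
    fix x y assume "x \<in> J" "y \<in> J"
    then obtain f n g m where *: "f \<in> N" "\<forall>i<n. fps_nth f i = 0" "fps_nth f n = x"
      "g \<in> N" "\<forall>i<m. fps_nth g i = 0" "fps_nth g m = y" unfolding J_def by blast
    obtain f' where f': "f' \<in> N" "\<forall>i<n + m. fps_nth f' i = 0" "fps_nth f' (n + m) = x"
      using shift[OF *(1,2), of m] *(3) by blast
    obtain g' where g': "g' \<in> N" "\<forall>i<n + m. fps_nth g' i = 0" "fps_nth g' (n + m) = y"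
      using shift[OF *(4,5), of n] *(6) by (metis add.commute)
    show "x + y \<in> J" unfolding J_def using f' g' submodule_overD(2)[OF N(1) f'(1) g'(1)]
      by (auto intro!: bexI[of _ "f' + g'"] exI[of _ "n + m"])
  next
    fix r x assume "r \<in> S" "x \<in> J"
    then obtain f n where *: "f \<in> N" "\<forall>i<n. fps_nth f i = 0" "fps_nth f n = x" unfolding J_def by blast
    then show "r * x \<in> J" unfolding J_def
      using submodule_overD(3)[OF N(1) const_T[OF \<open>r \<in> S\<close>] *(1)]
      by (auto intro!: bexI[of _ "fps_const r * f"] exI[of _ n])
  qed
  moreover have "J \<subseteq> S" using N(2) unfolding J_def fps_over_def by blast
  ultimately obtain B where B: "finite B" "B \<subseteq> J" "J \<subseteq> span_over S B"
    using noetherian_setE[OF S(2)] by metis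
  have "\<forall>b\<in>B. \<exists>f n. f \<in> N \<and> (\<forall>i<n. fps_nth f i = 0) \<and> fps_nth f n = b"
    using B(2) unfolding J_def by blast
  then obtain F0 n where F0: "\<And>b. b \<in> B \<Longrightarrow> F0 b \<in> N" "\<And>b. b \<in> B \<Longrightarrow> \<forall>i<n b. fps_nth (F0 b) i = 0"
    "\<And>b. b \<in> B \<Longrightarrow> fps_nth (F0 b) (n b) = b" by metis
  define d where "d = sum n B"
  have "\<forall>b\<in>B. \<exists>f. f \<in> N \<and> (\<forall>i<d. fps_nth f i = 0) \<and> fps_nth f d = b"
  proof
    fix b assume b: "b \<in> B"
    have "n b + (d - n b) = d" using member_le_sum[of b B n] B(1) b unfolding d_def by simp
    then show "\<exists>f. f \<in> N \<and> (\<forall>i<d. fps_nth f i = 0) \<and> fps_nth f d = b"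
      using shift[OF F0(1,2)[OF b], of "d - n b"] F0(3)[OF b] by auto
  qed
  then obtain F where F: "\<And>b. b \<in> B \<Longrightarrow> F b \<in> N" "\<And>b i. b \<in> B \<Longrightarrow> i < d \<Longrightarrow> fps_nth (F b) i = 0"
    "\<And>b. b \<in> B \<Longrightarrow> fps_nth (F b) d = b" by metis
  define S' where "S' = fps_const ` S"
  have S': "subring_set S'" "noetherian_set S'" "S' \<subseteq> fps_over S"
    unfolding S'_def using ring_map_fps_const S const_T
    by (auto intro!: subring_set_image noetherian_set_image)
  define M where "M = fps_cutoff d ` N"
  define Y :: "'a fps set" where "Y = (\<lambda>i. fps_X ^ i) ` {..<d}"
  note spanY = submodule_over_span[OF S'(1), of Y]
  have "submodule_over S' M"
    unfolding submodule_over_def M_def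
  proof (intro conjI ballI)
    show "0 \<in> fps_cutoff d ` N"
      using submodule_overD(1)[OF N(1)] by (intro image_eqI[of _ _ 0]) auto
  next
    fix x y assume "x \<in> fps_cutoff d ` N" "y \<in> fps_cutoff d ` N"
    then obtain f g where *: "f \<in> N" "g \<in> N" "x = fps_cutoff d f" "y = fps_cutoff d g" by blast
    then show "x + y \<in> fps_cutoff d ` N"
      using submodule_overD(2)[OF N(1) *(1,2)]
      by (intro image_eqI[of _ _ "f + g"]) (auto intro: fps_ext)
  next
    fix r x assume "r \<in> S'" "x \<in> fps_cutoff d ` N"
    then obtain s f where *: "s \<in> S" "r = fps_const s" "f \<in> N" "x = fps_cutoff d f" unfolding S'_def by blast
    then show "r * x \<in> fps_cutoff d ` N"
      using submodule_overD(3)[OF N(1) const_T[OF *(1)] *(3)]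
      by (intro image_eqI[of _ _ "fps_const s * f"]) (auto intro: fps_ext)
  qed
  moreover have "f \<in> span_over S' Y" if f: "f \<in> M" for f
  proof -
    obtain h where h: "h \<in> N" "f = fps_cutoff d h" using f unfolding M_def by blast
    have "f = (\<Sum>i<d. fps_const (fps_nth h i) * fps_X ^ i)"
    proof (rule fps_ext)
      fix j
      show "fps_nth f j = fps_nth (\<Sum>i<d. fps_const (fps_nth h i) * fps_X ^ i) j"
        using h(2) by (auto simp: fps_sum_nth if_distrib[of "\<lambda>u. _ * u"] cong: if_cong)
    qed
    moreover have "(\<Sum>i<d. fps_const (fps_nth h i) * fps_X ^ i) \<in> span_over S' Y"
      using h(1) N(2)
      by (intro submodule_over_sum[OF spanY] submodule_overD(3)[OF spanY] span_over_base[OF S'(1)])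
         (auto simp: Y_def S'_def fps_over_def)
    ultimately show ?thesis by metis
  qed
  then have "M \<subseteq> span_over S' Y" by blast
  moreover have "finite Y" unfolding Y_def by simp
  ultimately obtain H where H: "finite H" "H \<subseteq> M" "M \<subseteq> span_over S' H"
    using noetherian_submodule_fin_gen[OF S'(1,2)] by metis
  have "\<forall>h\<in>H. \<exists>f. f \<in> N \<and> fps_cutoff d f = h" using H(2) unfolding M_def by blast
  then obtain k where k: "\<And>h. h \<in> H \<Longrightarrow> k h \<in> N" "\<And>h. h \<in> H \<Longrightarrow> fps_cutoff d (k h) = h" by metis
  define G where "G = F ` B \<union> k ` H"
  have G: "finite G" "G \<subseteq> N" unfolding G_def using B H F(1) k by auto
  note spanG = submodule_over_span[OF T, of G]
  have "f \<in> span_over (fps_over S) G" if f: "f \<in> N" for f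
  proof -
    have "fps_cutoff d f \<in> span_over S' H" using H(3) f unfolding M_def by blast
    then obtain c where c: "fps_cutoff d f = (\<Sum>h\<in>H. c h * h)" "\<forall>h\<in>H. c h \<in> S'"
      unfolding span_over_def by blast
    define s where "s = (\<Sum>h\<in>H. c h * k h)"
    have s: "s \<in> span_over (fps_over S) G" unfolding s_def using c(2) S'(3)
      by (intro submodule_over_sum[OF spanG] submodule_overD(3)[OF spanG] span_over_base[OF T G(1)])
         (auto simp: G_def)
    then have "s \<in> N" using span_over_minimal[OF N(1) G(2)] by blast
    have "fps_nth f i = fps_nth s i" if "i < d" for i
    proof -
      have "fps_nth f i = fps_nth (fps_cutoff d f) i" using that by simp
      also have "\<dots> = (\<Sum>h\<in>H. fps_nth (c h * h) i)" unfolding c(1) fps_sum_nth ..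
      also have "\<dots> = (\<Sum>h\<in>H. fps_nth (c h * k h) i)"
      proof (intro sum.cong refl)
        fix h assume h: "h \<in> H"
        then obtain s where "c h = fps_const s" using c(2) unfolding S'_def by blast
        moreover have "fps_nth h i = fps_nth (k h) i" using arg_cong[OF k(2)[OF h], of "\<lambda>u. fps_nth u i"] that by simp
        ultimately show "fps_nth (c h * h) i = fps_nth (c h * k h) i" by simp
      qed
      finally show ?thesis unfolding s_def fps_sum_nth .
    qed
    then have "\<forall>i<d. fps_nth (f - s) i = 0" by simp
    then have "f - s \<in> span_over (fps_over S) (F ` B)"
    proof (intro fps_adic_span[OF S(1) N(1) B(1) F])
      show "f - s \<in> N" using submodule_over_diff[OF T N(1) f \<open>s \<in> N\<close>] .
      show "fps_nth f n \<in> span_over S B" if "f \<in> N" "\<forall>i<n. fps_nth f i = 0" for f n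
        using that B(3) unfolding J_def by blast
    qed auto
    then have "f - s \<in> span_over (fps_over S) G"
      using span_over_mono[OF T G(1), of "F ` B"] unfolding G_def by blast
    then show ?thesis using submodule_overD(2)[OF spanG _ s, of "f - s"] by simp
  qed
  then show "\<exists>G. finite G \<and> G \<subseteq> N \<and> N \<subseteq> span_over (fps_over S) G" using G by blast
qed


text \<open>Coefficients are settled in increasing order. If those below \<open>n\<close> lie in
  \<open>S\<close>, subtracting the truncation \<open>P\<close> keeps the common denominator
  \<open>d\<close>. The coefficient of \<open>d * (y - P) ^ k\<close> at \<open>m + n * k\<close> is
  then \<open>fps_nth d1 0 * fps_nth y n ^ k\<close>, so the hypothesis on \<open>S\<close> applies
  to \<open>fps_nth y n\<close>.\<close>

lemma completely_integrally_closed_fps_over: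
  fixes S :: "'k::field set"
  assumes S: "subring_set S" "completely_integrally_closed S"
  shows "completely_integrally_closed (fps_over S)"
  unfolding completely_integrally_closed_def
proof (intro allI impI, elim conjE)
  fix y d assume d: "d \<in> fps_over S" "d \<noteq> 0" "\<forall>n. d * y ^ n \<in> fps_over S"
  note T = subring_set_fps_over[OF S(1)]
  define m where "m = subdegree d"
  define d1 where "d1 = fps_shift m d"
  have d1: "d = fps_X ^ m * d1" "fps_nth d1 0 \<noteq> 0" "fps_nth d1 0 \<in> S"
    using d(1,2) unfolding d1_def m_def fps_over_def
    by (auto simp: fps_shift_times_fps_X_power mult.commute)
  have "fps_nth y n \<in> S" for n
  proof (induction n rule: less_induct)
    case (less n)
    define P where "P = fps_cutoff n y"
    define z where "z = fps_shift n y"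
    have P: "P \<in> fps_over S" using less subring_setD(1)[OF S(1)] unfolding P_def fps_over_def by auto
    have yP: "y - P = fps_X ^ n * z" unfolding P_def z_def
      by (metis add_diff_cancel_right' fps_shift_cutoff mult.commute)
    \<comment> \<open>The factor \<open>y ^ j\<close> is there for the induction: one factor
      \<open>y - P\<close> splits into \<open>y\<close>, which raises \<open>j\<close>, and
      \<open>P\<close>, which lies in \<open>fps_over S\<close>.\<close>
    have *: "\<forall>j. d * y ^ j * (y - P) ^ k \<in> fps_over S" for k
    proof (induction k)
      case 0
      then show ?case using d(3) by simp
    next
      case (Suc k)
      show ?case
      proof
        fix j
        have "d * y ^ j * (y - P) ^ Suc k = d * y ^ Suc j * (y - P) ^ k - P * (d * y ^ j * (y - P) ^ k)"
          by (simp add: algebra_simps)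
        then show "d * y ^ j * (y - P) ^ Suc k \<in> fps_over S"
          using Suc subring_setD(5,6)[OF T] P by metis
      qed
    qed
    have "fps_nth d1 0 * fps_nth y n ^ k \<in> S" for k
    proof -
      have "d * (y - P) ^ k = fps_X ^ (m + n * k) * (d1 * z ^ k)"
        unfolding yP d1(1) by (simp add: power_mult_distrib power_add power_mult)
      then have "fps_nth (d * (y - P) ^ k) (m + n * k) = fps_nth d1 0 * fps_nth y n ^ k"
        by (simp add: fps_X_power_mult_nth z_def fps_power_zeroth)
      moreover have "d * (y - P) ^ k \<in> fps_over S" using *[of k, rule_format, of 0] by simp
      ultimately show ?thesis unfolding fps_over_def by (metis (mono_tags) mem_Collect_eq)
    qed
    then show ?case using S(2) d1(2,3) unfolding completely_integrally_closed_def by blast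
  qed
  then show "y \<in> fps_over S" unfolding fps_over_def by blast
qed

text \<open>The embedding into power series preserves coefficients, so the property is
  inherited.\<close>

lemma completely_integrally_closed_poly_over:
  fixes S :: "'k::field set"
  assumes S: "subring_set S" "completely_integrally_closed S"
  shows "completely_integrally_closed (poly_over S)"
  unfolding completely_integrally_closed_def
proof (intro allI impI, elim conjE)
  fix y d assume d: "d \<in> poly_over S" "d \<noteq> 0" "\<forall>n. d * y ^ n \<in> poly_over S"
  have iff: "fps_of_poly p \<in> fps_over S \<longleftrightarrow> p \<in> poly_over S" for p
    unfolding fps_over_def poly_over_def by simp
  have "fps_of_poly d * fps_of_poly y ^ n \<in> fps_over S" for n
    using d(3) by (simp add: iff flip: fps_of_poly_power fps_of_poly_mult)
  then have "fps_of_poly y \<in> fps_over S"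
    using completely_integrally_closed_fps_over[OF S] d(1,2) iff[of d]
    unfolding completely_integrally_closed_def by (metis fps_of_poly_eq_iff fps_of_poly_0)
  then show "y \<in> poly_over S" by (simp add: iff)
qed

text \<open>
  The possible \<open>d\<close> form an ideal that is stable under multiplication by \<open>z\<close> and has a single generator
  \<open>m\<close>, so \<open>m\<close> divides \<open>m * z\<close>.
\<close>

lemma euclidean_almost_integral:
  fixes z :: "'a::euclidean_ring fract"
  assumes "d \<noteq> 0" "\<And>n. to_fract d * z ^ n \<in> range to_fract"
  shows "z \<in> range to_fract"
proof -
  define M where "M = {m. \<forall>n. to_fract m * z ^ n \<in> range to_fract}"
  have "\<exists>m. m \<in> M \<and> m \<noteq> 0" using assms unfolding M_def by blast
  then obtain m where m: "m \<in> M" "m \<noteq> 0"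
    and min: "\<And>f. f \<in> M \<Longrightarrow> f \<noteq> 0 \<Longrightarrow> euclidean_size m \<le> euclidean_size f"
    using ex_has_least_nat[of "\<lambda>m. m \<in> M \<and> m \<noteq> 0" _ euclidean_size] by blast
  obtain f where f: "to_fract f = to_fract m * z"
    using m(1) unfolding M_def by (auto dest: spec[of _ 1])
  have "to_fract (f mod m) * z ^ n \<in> range to_fract" for n
  proof -
    have "to_fract (f mod m) * z ^ n = to_fract (f - f div m * m) * z ^ n"
      by (simp only: minus_div_mult_eq_mod)
    also have "\<dots> = to_fract m * z ^ Suc n - to_fract (f div m) * (to_fract m * z ^ n)"
      by (simp add: f algebra_simps)
    finally have "to_fract (f mod m) * z ^ n = to_fract m * z ^ Suc n - to_fract (f div m) * (to_fract m * z ^ n)" .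
    moreover obtain a b where "to_fract m * z ^ Suc n = to_fract a" "to_fract m * z ^ n = to_fract b"
      using m(1) unfolding M_def by blast
    ultimately show ?thesis by (simp flip: to_fract_mult to_fract_diff)
  qed
  then have "f mod m \<in> M" unfolding M_def by blast
  then have "f mod m = 0" using min[of "f mod m"] mod_size_less[OF m(2), of f] by fastforce
  then obtain q where "f = m * q" by blast
  then have "z = to_fract q" using f m(2) by simp
  then show ?thesis by blast
qed

text \<open>There are two stages: \<open>z\<close> lands in the whole Euclidean ring, because
  \<open>d\<close> is a common denominator there, and then in \<open>T\<close>, by closedness
  relative to that ring.\<close>

lemma completely_integrally_closed_to_fract:
  fixes T :: "'a::euclidean_ring set"
  assumes "completely_integrally_closed T"
  shows "completely_integrally_closed (to_fract ` T)"
  unfolding completely_integrally_closed_def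
proof (intro allI impI, elim conjE)
  fix z d' assume *: "d' \<in> to_fract ` T" "d' \<noteq> 0" "\<forall>n. d' * z ^ n \<in> to_fract ` T"
  then obtain d where d: "d \<in> T" "d' = to_fract d" "d \<noteq> 0" by auto
  have "to_fract d * z ^ n \<in> range to_fract" for n
    using spec[OF *(3), of n] d(2) by auto
  then have "z \<in> range to_fract" by (rule euclidean_almost_integral[OF d(3)])
  then obtain y where y: "z = to_fract y" by blast
  have pow: "to_fract y ^ n = to_fract (y ^ n)" for n by (induction n) auto
  have "d * y ^ n \<in> T" for n
    using *(3) by (auto simp: d(2) y pow simp flip: to_fract_mult)
  then have "y \<in> T" using assms d unfolding completely_integrally_closed_def by blast
  then show "z \<in> to_fract ` T" using y by blast
qed

lemma ring_map_to_fract: "ring_map (to_fract :: 'a::idom \<Rightarrow> _)"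
  by (auto simp: ring_map_def)

section \<open>Prime ideals and local rings as sets\<close>

definition prime_in :: "'a::comm_ring_1 set \<Rightarrow> 'a set \<Rightarrow> bool"
  where "prime_in D P \<longleftrightarrow> submodule_over D P \<and> P \<subseteq> D \<and> 1 \<notin> P \<and>
    (\<forall>a\<in>D. \<forall>b\<in>D. a * b \<in> P \<longrightarrow> a \<in> P \<or> b \<in> P)"

text \<open>Locality in working form: everything outside the proper ideal \<open>M\<close> is a
  unit, with its inverse formed in the ambient field. The link to a unique maximal ideal is
  \<open>local_ring_subring_on_iff\<close>.\<close>

definition local_maximal :: "'k::field set \<Rightarrow> 'k set \<Rightarrow> bool"
  where "local_maximal L M \<longleftrightarrow>
    submodule_over L M \<and> M \<subseteq> L \<and> 1 \<notin> M \<and> (\<forall>x\<in>L - M. inverse x \<in> L)"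

lemma subring_on_simps [simp]:
  "carrier (subring_on D) = D" "x \<otimes>\<^bsub>subring_on D\<^esub> y = x * y" "x \<oplus>\<^bsub>subring_on D\<^esub> y = x + y"
  "\<one>\<^bsub>subring_on D\<^esub> = 1" "\<zero>\<^bsub>subring_on D\<^esub> = 0"
  by (simp_all add: subring_on_def ring_of_type_algebra_def)

lemma is_subring_iff: "is_subring D \<longleftrightarrow> subring_set (D :: 'k::field set)"
proof
  interpret K: cring "ring_of_type_algebra :: 'k ring" by (rule cring_from_type_algebra)
  have minus: "\<ominus>\<^bsub>ring_of_type_algebra\<^esub> x = - x" for x :: 'k
    by (rule K.minus_equality) (simp_all add: ring_of_type_algebra_def)
  {
    assume D: "is_subring D"
    note E = subringE[OF D, unfolded minus]
    show "subring_set D" unfolding subring_set_def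
    proof (intro conjI ballI)
      show "1 \<in> D" using E(3) by (simp add: ring_of_type_algebra_def)
      fix x y assume "x \<in> D" "y \<in> D"
      then show "x * y \<in> D" "x - y \<in> D"
        using E(6)[of x y] E(5)[of y] E(7)[of x "- y"] by (simp_all add: ring_of_type_algebra_def)
    qed
  next
    assume D: "subring_set D"
    show "is_subring D"
      by (rule K.subringI) (auto simp: minus subring_setD[OF D], auto simp: ring_of_type_algebra_def subring_setD[OF D])
  }
qed

lemma cring_subring_on: "subring_set D \<Longrightarrow> cring (subring_on (D :: 'k::field set))"
proof -
  interpret K: cring "ring_of_type_algebra :: 'k ring" by (rule cring_from_type_algebra)
  assume "subring_set D"
  then have "subcring D ring_of_type_algebra" using K.subcringI' is_subring_iff by blast
  then show ?thesis
    unfolding subring_on_def using K.subcring_iff[of D] by (simp add: ring_of_type_algebra_def)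
qed

lemma ideal_subring_on_iff:
  fixes D :: "'k::field set"
  assumes D: "subring_set D"
  shows "ideal I (subring_on D) \<longleftrightarrow> submodule_over D I \<and> I \<subseteq> D"
proof
  interpret R: cring "subring_on D" by (rule cring_subring_on[OF D])
  have minus: "\<ominus>\<^bsub>subring_on D\<^esub> x = - x" if "x \<in> D" for x
    by (rule R.minus_equality) (use that in \<open>simp_all add: subring_setD[OF D]\<close>)
  {
    assume "ideal I (subring_on D)"
    then interpret I: ideal I "subring_on D" .
    show "submodule_over D I \<and> I \<subseteq> D"
      unfolding submodule_over_def
      using I.zero_closed I.a_closed I.I_l_closed I.a_subset by simp
  next
    assume I: "submodule_over D I \<and> I \<subseteq> D"
    then have m: "- x \<in> I" if "x \<in> I" for x using submodule_over_uminus[OF D] that by blast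
    show "ideal I (subring_on D)"
    proof (rule idealI)
      show "ring (subring_on D)" by (rule R.ring_axioms)
      show "subgroup I (add_monoid (subring_on D))"
        using I m submodule_overD[of D I]
        by (intro R.add.subgroupI) (auto simp: minus simp flip: a_inv_def)
      fix a x assume "a \<in> I" "x \<in> carrier (subring_on D)"
      then have "x * a \<in> I" using I submodule_overD(3)[of D I] by simp
      then show "x \<otimes>\<^bsub>subring_on D\<^esub> a \<in> I" "a \<otimes>\<^bsub>subring_on D\<^esub> x \<in> I"
        by (simp_all add: mult.commute)
    qed
  }
qed

lemma primeideal_subring_on_iff:
  fixes D :: "'k::field set"
  assumes D: "subring_set D"
  shows "primeideal P (subring_on D) \<longleftrightarrow> prime_in D P"
proof
  assume "primeideal P (subring_on D)"
  then interpret P: primeideal P "subring_on D" .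
  have "1 \<notin> P" using P.one_imp_carrier P.I_notcarr by auto
  moreover have "submodule_over D P \<and> P \<subseteq> D"
    using P.ideal_axioms ideal_subring_on_iff[OF D] by blast
  ultimately show "prime_in D P" unfolding prime_in_def using P.I_prime by simp
next
  assume P: "prime_in D P"
  then have "ideal P (subring_on D)" unfolding prime_in_def ideal_subring_on_iff[OF D] by blast
  then show "primeideal P (subring_on D)"
    using P subring_setD(2)[OF D] unfolding prime_in_def
    by (intro primeidealI cring_subring_on[OF D]) auto
qed

lemma noetherian_subring_on:
  fixes D :: "'k::field set"
  assumes D: "subring_set D" and "noetherian_ring (subring_on D)"
  shows "noetherian_set D"
  unfolding noetherian_set_def
proof (intro allI impI)
  fix N assume N: "submodule_over D N \<and> N \<subseteq> D"
  interpret R: noetherian_ring "subring_on D" by fact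
  obtain A where A: "A \<subseteq> D" "finite A" "N = genideal (subring_on D) A"
    using R.finetely_gen[of N] N ideal_subring_on_iff[OF D] by auto
  have "A \<subseteq> N" using R.genideal_self[of A] A by simp
  moreover have "ideal (span_over D A) (subring_on D)"
    unfolding ideal_subring_on_iff[OF D]
    using submodule_over_span[OF D] span_over_minimal[OF submodule_over_subring[OF D] A(1)] by auto
  then have "N \<subseteq> span_over D A"
    unfolding A(3) by (rule R.genideal_minimal) (use span_over_base[OF D A(2)] in blast)
  ultimately show "\<exists>G. finite G \<and> G \<subseteq> N \<and> N \<subseteq> span_over D G" using A(2) by blast
qed

section \<open>Maximal ideals and local rings\<close>

lemma submodule_over_Union_chain:
  assumes "subset.chain {J. submodule_over D J \<and> P J} C" "C \<noteq> {}"
  shows "submodule_over D (\<Union>C)"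
  unfolding submodule_over_def
proof (intro conjI ballI)
  have C: "submodule_over D J" if "J \<in> C" for J using assms(1) that unfolding subset.chain_def by blast
  show "0 \<in> \<Union>C" using C assms(2) submodule_overD(1) by blast
  show "r * x \<in> \<Union>C" if "r \<in> D" "x \<in> \<Union>C" for r x using C that submodule_overD(3) by blast
  fix x y assume "x \<in> \<Union>C" "y \<in> \<Union>C"
  then obtain V U where XY: "V \<in> C" "U \<in> C" "x \<in> V" "y \<in> U" by blast
  then have "V \<subseteq> U \<or> U \<subseteq> V" using assms(1) unfolding subset.chain_def by blast
  then show "x + y \<in> \<Union>C" using XY C submodule_overD(2) by blast
qed

lemma maximalideal_subring_onI:
  fixes L :: "'k::field set"
  assumes L: "subring_set L" and M: "submodule_over L M" "M \<subseteq> L" "1 \<notin> M"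
    and max: "\<And>J. submodule_over L J \<Longrightarrow> J \<subseteq> L \<Longrightarrow> 1 \<notin> J \<Longrightarrow> M \<subseteq> J \<Longrightarrow> J = M"
  shows "maximalideal M (subring_on L)"
proof (rule maximalidealI)
  show "ideal M (subring_on L)" using M ideal_subring_on_iff[OF L] by blast
  show "carrier (subring_on L) \<noteq> M" using M(3) subring_setD(2)[OF L] by auto
next
  fix J assume J: "ideal J (subring_on L)" "M \<subseteq> J" "J \<subseteq> carrier (subring_on L)"
  then have J': "submodule_over L J" using ideal_subring_on_iff[OF L] by blast
  show "J = M \<or> J = carrier (subring_on L)"
  proof (cases "1 \<in> J")
    case True
    then have "x \<in> J" if "x \<in> L" for x using submodule_overD(3)[OF J' that True] by simp
    then show ?thesis using J(3) by auto
  next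
    case False
    then show ?thesis using max[OF J'] J by simp
  qed
qed

lemma exists_maximalideal_subring_on:
  fixes L :: "'k::field set"
  assumes L: "subring_set L" and J: "submodule_over L J" "J \<subseteq> L" "1 \<notin> J"
  shows "\<exists>M. maximalideal M (subring_on L) \<and> J \<subseteq> M"
proof -
  define A where "A = {M. submodule_over L M \<and> (M \<subseteq> L \<and> 1 \<notin> M \<and> J \<subseteq> M)}"
  have "\<exists>M\<in>A. \<forall>U\<in>A. M \<subseteq> U \<longrightarrow> U = M"
  proof (rule subset_Zorn_nonempty)
    show "A \<noteq> {}" using J unfolding A_def by blast
    fix C assume C: "C \<noteq> {}" "subset.chain A C"
    have "submodule_over L (\<Union>C)" using submodule_over_Union_chain[OF C(2)[unfolded A_def] C(1)] .
    moreover have "C \<subseteq> A" using C(2) unfolding subset.chain_def by blast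
    ultimately show "\<Union>C \<in> A" using C(1) unfolding A_def by blast
  qed
  then obtain M where M: "submodule_over L M" "M \<subseteq> L" "1 \<notin> M" "J \<subseteq> M"
    and "\<forall>U\<in>A. M \<subseteq> U \<longrightarrow> U = M" unfolding A_def by blast
  then have "maximalideal M (subring_on L)"
    by (intro maximalideal_subring_onI[OF L]) (auto simp: A_def)
  then show ?thesis using M(4) by blast
qed

text \<open>A non-unit outside the unique maximal ideal would generate a proper ideal and so lie in
  a second maximal ideal. Conversely, a proper ideal contains no unit, hence is contained in
  \<open>M\<close>.\<close>

lemma local_ring_subring_on_iff:
  fixes L :: "'k::field set"
  assumes L: "subring_set L"
  shows "local_ring (subring_on L) \<longleftrightarrow> (\<exists>M. local_maximal L M)"
proof
  assume "local_ring (subring_on L)"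
  then obtain M where M: "maximalideal M (subring_on L)"
    and uniq: "\<And>N. maximalideal N (subring_on L) \<Longrightarrow> N = M"
    unfolding local_ring_def by blast
  interpret M: maximalideal M "subring_on L" by fact
  have "1 \<notin> M" using M.one_imp_carrier M.I_notcarr by auto
  moreover have "submodule_over L M \<and> M \<subseteq> L"
    using M.ideal_axioms ideal_subring_on_iff[OF L] by blast
  moreover have "inverse x \<in> L" if x: "x \<in> L - M" for x
  proof (rule ccontr)
    assume inv: "inverse x \<notin> L"
    define J where "J = {r * x | r. r \<in> L}"
    have "submodule_over L J"
      unfolding submodule_over_def
    proof (intro conjI ballI)
      show "0 \<in> J" unfolding J_def using subring_setD(1)[OF L] by (intro CollectI exI[of _ 0]) simp
    next
      fix a b assume "a \<in> J" "b \<in> J"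
      then obtain r s where "a = r * x" "b = s * x" "r \<in> L" "s \<in> L" unfolding J_def by blast
      then show "a + b \<in> J" unfolding J_def using subring_setD(4)[OF L]
        by (intro CollectI exI[of _ "r + s"]) (auto simp: algebra_simps)
    next
      fix t a assume "t \<in> L" "a \<in> J"
      then obtain r where "a = r * x" "r \<in> L" unfolding J_def by blast
      then show "t * a \<in> J" unfolding J_def using subring_setD(6)[OF L] \<open>t \<in> L\<close>
        by (intro CollectI exI[of _ "t * r"]) (auto simp: algebra_simps)
    qed
    moreover have "J \<subseteq> L" unfolding J_def using x subring_setD(6)[OF L] by blast
    moreover have "1 \<notin> J"
    proof
      assume "1 \<in> J"
      then obtain r where "1 = r * x" "r \<in> L" unfolding J_def by blast
      then have "inverse x = r" by (metis inverse_unique mult.commute)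
      then show False using inv \<open>r \<in> L\<close> by blast
    qed
    ultimately obtain N where "maximalideal N (subring_on L)" "J \<subseteq> N"
      using exists_maximalideal_subring_on[OF L] by blast
    moreover have "x \<in> J" unfolding J_def using subring_setD(2)[OF L] by (intro CollectI exI[of _ 1]) simp
    ultimately show False using uniq x by blast
  qed
  ultimately show "\<exists>M. local_maximal L M" unfolding local_maximal_def by blast
next
  assume "\<exists>M. local_maximal L M"
  then obtain M where M: "submodule_over L M" "M \<subseteq> L" "1 \<notin> M" "\<And>x. x \<in> L - M \<Longrightarrow> inverse x \<in> L"
    unfolding local_maximal_def by blast
  have sub: "J \<subseteq> M" if J: "submodule_over L J" "J \<subseteq> L" "1 \<notin> J" for J
  proof (rule ccontr)
    assume "\<not> J \<subseteq> M"
    then obtain x where x: "x \<in> J" "x \<in> L - M" using J(2) by blast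
    then have "x \<noteq> 0" using submodule_overD(1)[OF M(1)] by blast
    then have "1 = inverse x * x" by simp
    then show False using submodule_overD(3)[OF J(1) M(4)[OF x(2)] x(1)] J(3) by simp
  qed
  have "maximalideal M (subring_on L)"
    using sub M by (intro maximalideal_subring_onI[OF L]) auto
  moreover have "N = M" if N: "maximalideal N (subring_on L)" for N
  proof -
    interpret N: maximalideal N "subring_on L" by fact
    have "1 \<notin> N" using N.one_imp_carrier N.I_notcarr by auto
    then have "N \<subseteq> M" using N.ideal_axioms ideal_subring_on_iff[OF L] sub by blast
    moreover have "M \<noteq> L" using M(3) subring_setD(2)[OF L] by blast
    moreover have "ideal M (subring_on L)" using M(1,2) ideal_subring_on_iff[OF L] by blast
    ultimately show ?thesis using N.I_maximal[of M] M(2) by simp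
  qed
  ultimately show "local_ring (subring_on L)"
    unfolding local_ring_def using cring_subring_on[OF L] by blast
qed

lemma local_maximal_prime_in:
  assumes L: "subring_set L" and M: "local_maximal L M"
  shows "prime_in L M"
proof -
  have "b \<in> M" if "a \<in> L - M" "a * b \<in> M" for a b
  proof -
    have "inverse a * (a * b) \<in> M"
      using M that submodule_overD(3)[of L M "inverse a" "a * b"] unfolding local_maximal_def by blast
    moreover have "a \<noteq> 0" using M that submodule_overD(1) unfolding local_maximal_def by blast
    ultimately show ?thesis by (simp flip: mult.assoc)
  qed
  then show ?thesis using M unfolding prime_in_def local_maximal_def by blast
qed

lemma local_maximal_inverse_iff:
  assumes "local_maximal L M" "x \<in> L" "x \<noteq> 0"
  shows "inverse x \<in> L \<longleftrightarrow> x \<notin> M"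
proof
  assume "inverse x \<in> L"
  then show "x \<notin> M"
    using assms submodule_overD(3)[of L M "inverse x" x] unfolding local_maximal_def by auto
qed (use assms in \<open>auto simp: local_maximal_def\<close>)

lemma going_down_iff:
  fixes D L :: "'k::field set"
  assumes D: "subring_set D" and L: "subring_set L"
  shows "going_down D L \<longleftrightarrow>
    (\<forall>P1 P2 Q2. prime_in D P1 \<and> prime_in D P2 \<and> P1 \<subseteq> P2 \<and> prime_in L Q2 \<and> Q2 \<inter> D = P2 \<longrightarrow>
      (\<exists>Q1. prime_in L Q1 \<and> Q1 \<subseteq> Q2 \<and> Q1 \<inter> D = P1))"
  unfolding going_down_def primeideal_subring_on_iff[OF D] primeideal_subring_on_iff[OF L] ..

lemma prime_in_Int:
  assumes "prime_in T Q" "subring_set D" "D \<subseteq> T"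
  shows "prime_in D (Q \<inter> D)"
  using assms unfolding prime_in_def submodule_over_def
  by (auto intro: subring_setD simp: subset_iff)

section \<open>Associated primes of fractions\<close>

text \<open>The union of a chain is finitely generated and its generators already lie in one member,
  so the union is that member and Zorn's lemma applies to an arbitrary nonempty family.\<close>

lemma noetherian_set_maximal:
  assumes T: "subring_set T" "noetherian_set T"
    and "\<A> \<noteq> {}" "\<And>J. J \<in> \<A> \<Longrightarrow> submodule_over T J \<and> J \<subseteq> T"
  obtains M where "M \<in> \<A>" "\<And>J. J \<in> \<A> \<Longrightarrow> M \<subseteq> J \<Longrightarrow> J = M"
proof -
  have "\<exists>M\<in>\<A>. \<forall>J\<in>\<A>. M \<subseteq> J \<longrightarrow> J = M"
  proof (rule subset_Zorn_nonempty[OF assms(3)])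
    fix C assume C: "C \<noteq> {}" "subset.chain \<A> C"
    have CA: "C \<subseteq> \<A>" using C(2) unfolding subset_chain_def by (rule conjunct1)
    then have "C \<subseteq> {J. submodule_over T J \<and> J \<subseteq> T}" using assms(4) by auto
    then have "subset.chain {J. submodule_over T J \<and> J \<subseteq> T} C"
      using C(2) unfolding subset_chain_def by (metis (no_types, lifting))
    then have "submodule_over T (\<Union>C)" using submodule_over_Union_chain[of T "\<lambda>J. J \<subseteq> T" C] C(1) by simp
    moreover have "\<Union>C \<subseteq> T" using CA assms(4) by (meson Union_least subsetD)
    ultimately obtain G where G: "finite G" "G \<subseteq> \<Union>C" "\<Union>C \<subseteq> span_over T G"
      using noetherian_setE[OF T(2)] by metis
    obtain J where J: "J \<in> C" "G \<subseteq> J"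
      using finite_subset_Union_chain[OF G(1,2) C(1,2)] by blast
    then have "J \<in> \<A>" using CA by blast
    then have "span_over T G \<subseteq> J" using span_over_minimal J(2) assms(4) by meson
    then have "\<Union>C = J" using G(3) J(1) by blast
    then show "\<Union>C \<in> \<A>" using \<open>J \<in> \<A>\<close> by simp
  qed
  then show thesis using that by blast
qed

text \<open>
  The prime \<open>q\<close> is a maximal element among the conductors of the multiples \<open>t * x\<close> outside the
  localization; after clearing denominators, \<open>q\<close> is the conductor of some \<open>y\<close>. No nonzero ideal of \<open>T\<close> is
  stable under \<open>y\<close>, which makes \<open>q\<close> minimal among the nonzero primes.
\<close>

lemma exists_associated_prime:
  fixes T W :: "'f::field set"
  assumes T: "subring_set T" "noetherian_set T" "completely_integrally_closed T"
    and W: "W \<subseteq> T" "1 \<in> W" "0 \<notin> W" "\<And>v w. v \<in> W \<Longrightarrow> w \<in> W \<Longrightarrow> v * w \<in> W"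
    and x: "x \<in> frac_field T" "\<not> (\<exists>a\<in>T. \<exists>w\<in>W. x = a / w)"
  obtains q t where "prime_in T q" "q \<inter> W = {}" "t \<in> q" "t * x \<in> T - q"
    "\<And>I. prime_in T I \<Longrightarrow> I \<subseteq> q \<Longrightarrow> I \<noteq> {0} \<Longrightarrow> I = q"
proof -
  define TW where "TW = {a / w | a w. a \<in> T \<and> w \<in> W}"
  have nz: "w \<noteq> 0" if "w \<in> W" for w using that W(3) by blast
  have TW: "submodule_over T TW"
    unfolding submodule_over_def
  proof (intro conjI ballI)
    show "0 \<in> TW" unfolding TW_def using subring_setD(1)[OF T(1)] W(2)
      by (intro CollectI exI[of _ 0] exI[of _ 1]) simp
  next
    fix u v assume "u \<in> TW" "v \<in> TW"
    then obtain a w b w' where *: "u = a / w" "v = b / w'" "a \<in> T" "b \<in> T" "w \<in> W" "w' \<in> W"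
      unfolding TW_def by blast
    then have "u + v = (a * w' + b * w) / (w * w')" using nz by (simp add: field_simps)
    moreover have "a * w' + b * w \<in> T" using * W(1) subring_setD(4,6)[OF T(1)] by blast
    ultimately show "u + v \<in> TW" unfolding TW_def using * W(4) by blast
  next
    fix r v assume "r \<in> T" "v \<in> TW"
    then obtain b w' where *: "v = b / w'" "b \<in> T" "w' \<in> W" unfolding TW_def by blast
    moreover have "r * v = (r * b) / w'" using * by simp
    ultimately show "r * v \<in> TW" unfolding TW_def using subring_setD(6)[OF T(1) \<open>r \<in> T\<close>] by blast
  qed
  have TW_I: "a \<in> TW" if wa: "w \<in> W" "w * a \<in> TW" for a w
  proof -
    obtain b w' where *: "w * a = b / w'" "b \<in> T" "w' \<in> W" using wa unfolding TW_def by blast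
    then have "a = b / (w' * w)" using nz[OF wa(1)] by (metis divide_divide_eq_left nonzero_mult_div_cancel_left)
    then show ?thesis unfolding TW_def using * W(4) wa(1) by blast
  qed
  have "T \<subseteq> TW"
  proof
    fix a assume "a \<in> T"
    then show "a \<in> TW" unfolding TW_def using W(2) by (intro CollectI exI[of _ a] exI[of _ 1]) simp
  qed
  have "x \<notin> TW" using x(2) unfolding TW_def by blast
  define K where "K t = {s \<in> T. s * (t * x) \<in> TW}" for t
  have K: "submodule_over T (K t)" for t
    unfolding submodule_over_def K_def
    using submodule_overD[OF TW] subring_setD[OF T(1)] by (auto simp: distrib_right mult.assoc)
  define \<A> where "\<A> = {K t | t. t \<in> T \<and> t * x \<notin> TW}"
  have "\<A> \<noteq> {}" unfolding \<A>_def using \<open>x \<notin> TW\<close> subring_setD(2)[OF T(1)]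
    by (metis (mono_tags, lifting) empty_iff mem_Collect_eq mult_1)
  moreover have "\<And>J. J \<in> \<A> \<Longrightarrow> submodule_over T J \<and> J \<subseteq> T" using K unfolding \<A>_def K_def by blast
  ultimately obtain q where q: "q \<in> \<A>" "\<And>J. J \<in> \<A> \<Longrightarrow> q \<subseteq> J \<Longrightarrow> J = q"
    using noetherian_set_maximal[OF T(1,2)] by metis
  obtain t where t: "q = K t" "t \<in> T" "t * x \<notin> TW" using q(1) unfolding \<A>_def by blast
  have qT: "submodule_over T q" "q \<subseteq> T" using K t(1) unfolding K_def by auto
  have "1 \<notin> q" unfolding t(1) K_def using t(3) by simp
  have prime: "prime_in T q"
    unfolding prime_in_def
  proof (intro conjI ballI impI qT \<open>1 \<notin> q\<close>)
    fix a b assume ab: "a \<in> T" "b \<in> T" "a * b \<in> q"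
    show "a \<in> q \<or> b \<in> q"
    proof (rule disjCI)
      assume "b \<notin> q"
      then have "b * t * x \<notin> TW" using ab(2) unfolding t(1) K_def by (simp add: mult.assoc)
      then have "K (b * t) \<in> \<A>" unfolding \<A>_def using ab(2) t(2) subring_setD(6)[OF T(1)] by blast
      moreover have "q \<subseteq> K (b * t)"
      proof
        fix s assume "s \<in> q"
        then have "s \<in> T" "b * (s * (t * x)) \<in> TW"
          unfolding t(1) K_def using submodule_overD(3)[OF TW ab(2)] by auto
        moreover have "b * (s * (t * x)) = s * (b * t * x)" by simp
        ultimately show "s \<in> K (b * t)" unfolding K_def by simp
      qed
      ultimately have "K (b * t) = q" using q(2) by blast
      moreover have "a \<in> K (b * t)"
        using ab(1,3) unfolding t(1) K_def by (simp add: mult.assoc)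
      ultimately show "a \<in> q" by blast
    qed
  qed
  have disj: "q \<inter> W = {}"
    using TW_I t(3) unfolding t(1) K_def by blast
  obtain G where G: "finite G" "G \<subseteq> q" "q \<subseteq> span_over T G"
    using noetherian_setE[OF T(2) qT] by metis
  have "\<exists>w\<in>W. \<forall>g\<in>G. w * (g * (t * x)) \<in> T"
    using G(1,2)
  proof (induction G rule: finite_induct)
    case empty
    then show ?case using W(2) by blast
  next
    case (insert g G)
    then obtain w where w: "w \<in> W" "\<forall>g\<in>G. w * (g * (t * x)) \<in> T" by blast
    have "g * (t * x) \<in> TW" using insert.prems unfolding t(1) K_def by blast
    then obtain a v where v: "g * (t * x) = a / v" "a \<in> T" "v \<in> W" unfolding TW_def by blast
    have "(v * w) * (h * (t * x)) \<in> T" if h: "h \<in> insert g G" for h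
    proof (cases "h = g")
      case True
      then have "(v * w) * (h * (t * x)) = w * a" using v nz by simp
      moreover have "w * a \<in> T" using v(2) w(1) W(1) subring_setD(6)[OF T(1)] by blast
      ultimately show ?thesis by (simp only:)
    next
      case False
      then have "w * (h * (t * x)) \<in> T" using h w(2) by blast
      then have "v * (w * (h * (t * x))) \<in> T" using v(3) W(1) subring_setD(6)[OF T(1)] by blast
      then show ?thesis by (simp add: mult.assoc)
    qed
    then show ?case using W(4) v(3) w(1) by blast
  qed
  then obtain w where w: "w \<in> W" "\<And>g. g \<in> G \<Longrightarrow> w * (g * (t * x)) \<in> T" by blast
  define y where "y = w * (t * x)"
  have qy: "a * y \<in> T" if "a \<in> q" for a
  proof -
    have "submodule_over T {a. a * y \<in> T}"
      unfolding submodule_over_def using subring_setD[OF T(1)] by (auto simp: distrib_right mult.assoc)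
    moreover have "G \<subseteq> {a. a * y \<in> T}" using w(2) unfolding y_def by (auto simp: ac_simps)
    ultimately show ?thesis using span_over_minimal[of T "{a. a * y \<in> T}" G] G(3) that by blast
  qed
  have "y \<notin> T" using TW_I[OF w(1)] t(3) \<open>T \<subseteq> TW\<close> unfolding y_def by blast
  have stable: "J = {0}" if J: "submodule_over T J" "J \<subseteq> T" "\<And>a. a \<in> J \<Longrightarrow> a * y \<in> J" for J
  proof (rule ccontr)
    assume "J \<noteq> {0}"
    then obtain a where a: "a \<in> J" "a \<noteq> 0" using submodule_overD(1)[OF J(1)] by blast
    have "a * y ^ n \<in> J" for n
    proof (induction n)
      case (Suc n)
      then show ?case using J(3)[of "a * y ^ n"] by (simp add: ac_simps)
    qed (use a in simp)
    then show False
      using T(3) a J(2) \<open>y \<notin> T\<close> unfolding completely_integrally_closed_def by blast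
  qed
  have "q \<noteq> {0}"
  proof -
    obtain a b where ab: "x = a / b" "a \<in> T" "b \<in> T" "b \<noteq> 0" using x(1) by (blast elim: frac_field_memE)
    then have "b * (t * x) = t * a" by simp
    then have "b \<in> q" using ab t(2) subring_setD(6)[OF T(1)] \<open>T \<subseteq> TW\<close> unfolding t(1) K_def by auto
    then show ?thesis using ab(4) by blast
  qed
  \<comment> \<open>Since \<open>u * y\<close> lies in \<open>T\<close> but not in \<open>q\<close>,
    the identity \<open>v * (u * y) = (v * y) * u\<close> makes every \<open>v\<close> in
    \<open>q\<close> a multiple of \<open>u\<close> after localizing: \<open>u\<close> is a
    uniformizer at \<open>q\<close>. A nonzero prime \<open>I\<close> inside \<open>q\<close> is not
    stable under \<open>y\<close> either, and this forces \<open>u\<close> into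
    \<open>I\<close>.\<close>
  then obtain u where u: "u \<in> q" "u * y \<notin> q" using stable[OF qT] by blast
  have wt: "w * t \<in> T" using w(1) W(1) t(2) subring_setD(6)[OF T(1)] by blast
  have min: "I = q" if I: "prime_in T I" "I \<subseteq> q" "I \<noteq> {0}" for I
  proof -
    have I': "submodule_over T I" "I \<subseteq> T" "\<And>a b. a \<in> T \<Longrightarrow> b \<in> T \<Longrightarrow> a * b \<in> I \<Longrightarrow> a \<in> I \<or> b \<in> I"
      using I(1) unfolding prime_in_def by auto
    obtain a where a: "a \<in> I" "a * y \<notin> I" using stable[OF I'(1,2)] I(3) by blast
    have "u * (a * y) = (u * y) * a" by simp
    then have "u * (a * y) \<in> I" using submodule_overD(3)[OF I'(1) qy[OF u(1)] a(1)] by (simp only:)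
    then have "u \<in> I" using I'(3)[of u "a * y"] a u(1) qT(2) qy I(2) by blast
    have "v \<in> I" if v: "v \<in> q" for v
    proof -
      have "v * (u * y) = (v * y) * u" by simp
      then have "v * (u * y) \<in> I" using submodule_overD(3)[OF I'(1) qy[OF v] \<open>u \<in> I\<close>] by (simp only:)
      then show ?thesis using I'(3)[of v "u * y"] u v qT(2) qy I(2) by blast
    qed
    then show ?thesis using I(2) by blast
  qed
  show thesis
  proof (rule that[OF prime disj _ _ min])
    \<comment> \<open>This product is the element returned as \<open>t\<close>; multiplied by
      \<open>x\<close> it gives \<open>u * y\<close>.\<close>
    show "(w * t) * u \<in> q" using submodule_overD(3)[OF qT(1) wt u(1)] .
    have "(w * t) * u * x = u * y" unfolding y_def by simp
    then show "(w * t) * u * x \<in> T - q" using u qy[OF u(1)] by (metis Diff_iff)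
  qed
qed

section \<open>Pullbacks along a common ideal\<close>

text \<open>
  The embedding \<open>c\<close> splits both \<open>D / I = R\<close> and \<open>T / I = S\<close>, so the quotients never have to be formed.
  The larger module \<open>J\<close>, on which all of \<open>range c\<close> acts, guarantees that the splitting survives localization.
\<close>

locale conductor_square =
  fixes R S :: "'k::field set" and c :: "'k \<Rightarrow> 'f::field" and I J D T :: "'f set"
  assumes R: "subring_set R" and S: "subring_set S" "R \<subseteq> S" "S \<subseteq> frac_field R"
    and c: "ring_map c"
    and T: "subring_set T" "noetherian_set T" "completely_integrally_closed T"
    and I: "submodule_over T I" "I \<noteq> {0}" "I \<subseteq> J"
    and J: "submodule_over (range c) J" "\<And>s. c s \<in> J \<Longrightarrow> s = 0"
    and T_eq: "T = {c s + i | s i. s \<in> S \<and> i \<in> I}"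
    and D_eq: "D = {c r + i | r i. r \<in> R \<and> i \<in> I}"
begin

lemmas cD = ring_mapD[OF c]

lemma c_eq_0_iff: "c s = 0 \<longleftrightarrow> s = 0"
  using J(2)[of s] submodule_overD(1)[OF J(1)] cD(1) by metis

lemma c_inverse: "c (inverse s) = inverse (c s)"
proof (cases "s = 0")
  case True then show ?thesis by (simp add: cD)
next
  case False
  then have "c (inverse s) * c s = 1" by (simp flip: cD(4) add: cD(2))
  then show ?thesis by (metis inverse_unique mult.commute)
qed

lemma c_divide: "c (s / t) = c s / c t"
  by (simp add: divide_inverse cD c_inverse)

lemma c_S: "s \<in> S \<Longrightarrow> c s \<in> T"
  unfolding T_eq using submodule_overD(1)[OF I(1)] by force

lemma c_R: "r \<in> R \<Longrightarrow> c r \<in> D"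
  unfolding D_eq using submodule_overD(1)[OF I(1)] by force

lemma I_D: "I \<subseteq> D"
  unfolding D_eq using subring_setD(1)[OF R] cD(1) by force

lemma D_T: "D \<subseteq> T"
  unfolding D_eq T_eq using S(2) by blast

lemma D: "subring_set D"
  unfolding subring_set_def
proof (intro conjI ballI)
  show "1 \<in> D" using c_R[OF subring_setD(2)[OF R]] by (simp add: cD)
  fix x y assume "x \<in> D" "y \<in> D"
  then obtain r i s j where *: "x = c r + i" "y = c s + j" "r \<in> R" "s \<in> R" "i \<in> I" "j \<in> I"
    unfolding D_eq by blast
  have "x - y = c (r - s) + (i - j)" using * by (simp add: cD)
  moreover have "i - j \<in> I" using submodule_over_diff[OF T(1) I(1)] * by blast
  ultimately show "x - y \<in> D" unfolding D_eq using subring_setD(5)[OF R] * by blast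
  have "x * y = c (r * s) + (c r * j + y * i)" using * by (simp add: cD algebra_simps)
  moreover have "c r * j + y * i \<in> I"
    using submodule_overD(2,3)[OF I(1)] * \<open>y \<in> D\<close> D_T c_R by blast
  ultimately show "x * y \<in> D" unfolding D_eq using subring_setD(6)[OF R] * by blast
qed

lemma I_T: "I \<subseteq> T" using I_D D_T by blast

text \<open>For a product in \<open>I\<close>, the product of the constant parts is a constant in
  \<open>J\<close>, hence 0; this is \<open>T / I = S\<close> being a domain.\<close>

lemma I_prime: "prime_in T I"
  unfolding prime_in_def
proof (intro conjI ballI impI I(1) I_T)
  show "1 \<notin> I" using J(2)[of 1] I(3) cD(2) by auto
  fix a b assume "a \<in> T" "b \<in> T" "a * b \<in> I"
  then obtain s i t j where *: "a = c s + i" "b = c t + j" "s \<in> S" "t \<in> S" "i \<in> I" "j \<in> I"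
    unfolding T_eq by blast
  have "c (s * t) = a * b - (c s * j + b * i)" using * by (simp add: cD algebra_simps)
  moreover have "c s * j + b * i \<in> I" using * c_S \<open>b \<in> T\<close> submodule_overD(2,3)[OF I(1)] by blast
  ultimately have "c (s * t) \<in> I" using submodule_over_diff[OF T(1) I(1) \<open>a * b \<in> I\<close>] by simp
  then have "s = 0 \<or> t = 0" using J(2) I(3) by (metis mult_eq_0_iff subsetD)
  then show "a \<in> I \<or> b \<in> I" using * by (auto simp: cD)
qed

text \<open>The set is the preimage of \<open>P\<close> under the projection from \<open>D\<close>
  to \<open>R\<close>; \<open>J\<close> makes the constant part of an element unique.\<close>

lemma prime_in_lift:
  assumes "prime_in R P"
  shows "prime_in D {c r + i | r i. r \<in> P \<and> i \<in> I}" (is "prime_in D ?P")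
proof -
  have P: "submodule_over R P" "P \<subseteq> R" "1 \<notin> P" "\<And>a b. a \<in> R \<Longrightarrow> b \<in> R \<Longrightarrow> a * b \<in> P \<Longrightarrow> a \<in> P \<or> b \<in> P"
    using assms unfolding prime_in_def by auto
  show ?thesis
    unfolding prime_in_def
  proof (intro conjI ballI impI)
    show "submodule_over D ?P"
      unfolding submodule_over_def
    proof (intro conjI ballI)
      have "0 = c 0 + 0" by (simp add: cD)
      then show "0 \<in> ?P" using submodule_overD(1)[OF P(1)] submodule_overD(1)[OF I(1)] by blast
    next
      fix x y assume "x \<in> ?P" "y \<in> ?P"
      then obtain r i s j where *: "x = c r + i" "y = c s + j" "r \<in> P" "s \<in> P" "i \<in> I" "j \<in> I" by blast
      then have "x + y = c (r + s) + (i + j)" by (simp add: cD)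
      then show "x + y \<in> ?P" using submodule_overD(2)[OF P(1)] submodule_overD(2)[OF I(1)] * by blast
    next
      fix x y assume "x \<in> D" "y \<in> ?P"
      then obtain r i s j where *: "x = c r + i" "y = c s + j" "r \<in> R" "s \<in> P" "i \<in> I" "j \<in> I"
        unfolding D_eq by blast
      then have "x * y = c (r * s) + (x * j + c s * i)" by (simp add: cD algebra_simps)
      moreover have "x * j + c s * i \<in> I"
        using submodule_overD(2,3)[OF I(1)] * \<open>x \<in> D\<close> D_T c_R P(2) by blast
      ultimately show "x * y \<in> ?P" using submodule_overD(3)[OF P(1)] * by blast
    qed
    show "?P \<subseteq> D" unfolding D_eq using P(2) by blast
    show "1 \<notin> ?P"
    proof
      assume "1 \<in> ?P"
      then obtain r i where *: "1 = c r + i" "r \<in> P" "i \<in> I" by blast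
      then have "c (1 - r) = i" by (simp add: cD diff_eq_eq add.commute)
      then have "1 - r = 0" using J(2) I(3) *(3) by blast
      then show False using P(3) * by simp
    qed
    fix x y assume "x \<in> D" "y \<in> D" "x * y \<in> ?P"
    then obtain r i s j p k where *: "x = c r + i" "y = c s + j" "r \<in> R" "s \<in> R" "i \<in> I" "j \<in> I"
      "x * y = c p + k" "p \<in> P" "k \<in> I"
      unfolding D_eq by blast
    then have "c (r * s - p) = k - (x * j + c s * i)" by (simp add: cD algebra_simps)
    moreover have "x * j + c s * i \<in> I"
      using submodule_overD(2,3)[OF I(1)] * \<open>x \<in> D\<close> D_T c_R by blast
    ultimately have "c (r * s - p) \<in> J" using submodule_over_diff[OF T(1) I(1)] *(9) I(3) by (metis subsetD)
    then have "r * s \<in> P" using J(2) *(8) by fastforce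
    then show "x \<in> ?P \<or> y \<in> ?P" using P(4)[of r s] * by blast
  qed
qed

section \<open>Bounding a local overring that satisfies going-down\<close>

context
  fixes L m p :: "'f set"
  assumes L: "overring D L" and m: "local_maximal L m" and gd: "going_down D L"
  defines "p \<equiv> m \<inter> D"
begin

lemma L_subring: "subring_set L" and D_L: "D \<subseteq> L"
  using L unfolding overring_def is_subring_iff by auto

lemma m_prime: "prime_in L m" using local_maximal_prime_in[OF L_subring m] .

lemma p_prime: "prime_in D p" unfolding p_def using prime_in_Int[OF m_prime D D_L] .

lemma inverse_L: "w \<in> D - p \<Longrightarrow> inverse w \<in> L"
  using m D_L unfolding local_maximal_def p_def by blast

lemma denominators: "1 \<in> D - p" "0 \<notin> D - p" "v \<in> D - p \<Longrightarrow> w \<in> D - p \<Longrightarrow> v * w \<in> D - p"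
proof -
  note p = p_prime[unfolded prime_in_def]
  show "1 \<in> D - p" using p subring_setD(2)[OF D] by blast
  show "0 \<notin> D - p" using p submodule_overD(1)[of D p] by blast
  show "v * w \<in> D - p" if "v \<in> D - p" "w \<in> D - p"
    using p subring_setD(6)[OF D] that by (metis Diff_iff)
qed

lemma overring_in_localization:
  assumes x: "x \<in> L"
  obtains a w where "a \<in> T" "w \<in> D - p" "x = a / w"
proof (rule ccontr)
  assume "\<not> thesis"
  then have not: "\<not> (\<exists>a\<in>T. \<exists>w\<in>D - p. x = a / w)" using that by blast
  have xf: "x \<in> frac_field T" using x L D_T unfolding overring_def frac_field_def by blast
  have DT: "D - p \<subseteq> T" using D_T by blast
  obtain q t where q: "prime_in T q" "q \<inter> (D - p) = {}" "t \<in> q" "t * x \<in> T - q"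
    and min: "\<And>I. prime_in T I \<Longrightarrow> I \<subseteq> q \<Longrightarrow> I \<noteq> {0} \<Longrightarrow> I = q"
  proof (rule exists_associated_prime[OF T DT denominators xf not])
    fix q t
    assume "prime_in T q" "q \<inter> (D - p) = {}" "t \<in> q" "t * x \<in> T - q"
      "\<And>I. prime_in T I \<Longrightarrow> I \<subseteq> q \<Longrightarrow> I \<noteq> {0} \<Longrightarrow> I = q"
    then show thesis by (rule that)
  qed
  have q': "submodule_over T q" "q \<subseteq> T" "\<And>a b. a \<in> T \<Longrightarrow> b \<in> T \<Longrightarrow> a * b \<in> q \<Longrightarrow> a \<in> q \<or> b \<in> q"
    using q(1) unfolding prime_in_def by auto
  obtain Q where Q: "prime_in L Q" "Q \<subseteq> m" "Q \<inter> D = q \<inter> D"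
  proof -
    have "q \<inter> D \<subseteq> p" using q(2) by blast
    then show thesis
      using gd[unfolded going_down_iff[OF D L_subring], rule_format, of "q \<inter> D" p m]
        prime_in_Int[OF q(1) D D_T] p_prime m_prime that unfolding p_def by blast
  qed
  \<comment> \<open>Such an \<open>e\<close> moves \<open>t\<close> and \<open>t * x\<close> from
    \<open>T\<close> into \<open>D\<close> while staying outside \<open>q\<close>. For
    \<open>q = I\<close> a constant works, as elements of \<open>S\<close> have denominators in
    \<open>R\<close>. Otherwise any element of \<open>I\<close> outside \<open>q\<close> works,
    because \<open>I\<close> is an ideal of \<open>T\<close> inside \<open>D\<close>. Minimality of
    \<open>q\<close> excludes \<open>I\<close> lying strictly inside it.\<close>
  have "\<exists>e\<in>D - q. e * t \<in> D \<and> e * (t * x) \<in> D"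
  proof (cases "I \<subseteq> q")
    case True
    then have qI: "q = I" using min[OF I_prime _ I(2)] by simp
    have "\<exists>r\<in>R. r \<noteq> 0 \<and> c r * a \<in> D" if a: "a \<in> T" for a
    proof -
      obtain s i where *: "a = c s + i" "s \<in> S" "i \<in> I" using a unfolding T_eq by blast
      obtain r1 r where r: "s = r1 / r" "r1 \<in> R" "r \<in> R" "r \<noteq> 0"
        using S(3) *(2) by (blast elim: frac_field_memE)
      then have "c r * a = c r1 + c r * i" using * by (simp add: algebra_simps flip: cD(4))
      moreover have "c r * i \<in> I" using submodule_overD(3)[OF I(1)] * c_R r D_T by blast
      ultimately have "c r * a \<in> D" unfolding D_eq using r(2) by blast
      then show ?thesis using r by blast
    qed
    then obtain r1 r2 where r: "r1 \<in> R" "r1 \<noteq> 0" "c r1 * t \<in> D" "r2 \<in> R" "r2 \<noteq> 0" "c r2 * (t * x) \<in> D"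
      using q'(2) q(3,4) by blast
    have "c (r1 * r2) \<notin> I" using J(2)[of "r1 * r2"] I(3) r by auto
    moreover have "c (r1 * r2) * t \<in> D"
      using subring_setD(6)[OF D c_R[OF r(4)] r(3)] by (simp add: cD ac_simps)
    moreover have "c (r1 * r2) * (t * x) \<in> D"
      using subring_setD(6)[OF D c_R[OF r(1)] r(6)] by (simp add: cD ac_simps)
    ultimately show ?thesis using c_R subring_setD(6)[OF R] r qI by blast
  next
    case False
    then obtain j where j: "j \<in> I" "j \<notin> q" by blast
    have "j * a \<in> D" if "a \<in> T" for a
      using submodule_overD(3)[OF I(1) that j(1)] I_D by (auto simp: mult.commute)
    then show ?thesis using j I_D q(3,4) q'(2) by blast
  qed
  then obtain e where e: "e \<in> D" "e \<notin> q" "e * t \<in> D" "e * (t * x) \<in> D" by blast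
  \<comment> \<open>As \<open>x\<close> is in \<open>L\<close>, it carries \<open>e * t\<close> to
    \<open>e * (t * x)\<close> within \<open>Q\<close>. Contraction to \<open>D\<close> then puts
    \<open>e * (t * x)\<close> into \<open>q\<close>, although neither factor is there.\<close>
  have "e * t \<in> q" using submodule_overD(3)[OF q'(1)] e(1) D_T q(3) by blast
  then have "e * t \<in> Q" using Q(3) e(3) by blast
  then have "x * (e * t) \<in> Q" using Q(1) x submodule_overD(3) unfolding prime_in_def by blast
  then have "e * (t * x) \<in> Q" by (simp add: ac_simps)
  then have "e * (t * x) \<in> q" using Q(3) e(4) by blast
  then show False using q'(3)[of e "t * x"] e(1,2) q(4) D_T by blast
qed

lemma localization_subset: "localization_at D p \<subseteq> L"
  unfolding localization_at_def using inverse_L D_L subring_setD(6)[OF L_subring]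
  by (auto simp: divide_inverse)

text \<open>An element of \<open>I\<close> outside \<open>p\<close> is an admissible denominator and
  multiplies every numerator from \<open>T\<close> into \<open>D\<close>.\<close>

lemma overring_eq_localization_no_conductor:
  assumes "\<not> I \<subseteq> p"
  shows "L = localization_at D p"
proof (intro equalityI localization_subset subsetI)
  fix x assume "x \<in> L"
  then obtain a w where aw: "a \<in> T" "w \<in> D - p" "x = a / w" using overring_in_localization by blast
  obtain j where j: "j \<in> I" "j \<in> D - p" using assms I_D by blast
  have "x = (a * j) / (j * w)" using aw denominators(2) j by auto
  moreover have "a * j \<in> D" using submodule_overD(3)[OF I(1) aw(1) j(1)] I_D by blast
  ultimately show "x \<in> localization_at D p"
    unfolding localization_at_def using denominators(3)[OF j(2) aw(2)] by blast
qed

section \<open>Reduction to \<open>R\<close> when \<open>p\<close> contains \<open>I\<close>\<close>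

context
  assumes I_p: "I \<subseteq> p"
begin

text \<open>This localization of \<open>I\<close> is the kernel of the projection from
  \<open>L\<close> onto \<open>L0\<close>.\<close>

definition "IW = {i / w | i w. i \<in> I \<and> w \<in> D - p}"

text \<open>The constants in \<open>L\<close> stand in for the quotient of \<open>L\<close> by
  \<open>IW\<close>; \<open>decomposition\<close> and \<open>c_IW\<close> justify this.\<close>

definition "L0 = {s. c s \<in> L}"

text \<open>As \<open>I\<close> is contained in \<open>p\<close>, dropping the part in
  \<open>I\<close> cannot move \<open>w\<close> into \<open>p\<close>, so the constant part is again
  a denominator.\<close>

lemma denominatorE:
  assumes "w \<in> D - p"
  obtains r j where "w = c r + j" "r \<in> R" "j \<in> I" "r \<noteq> 0" "c r \<in> D - p"
proof -
  obtain r j where *: "w = c r + j" "r \<in> R" "j \<in> I" using assms unfolding D_eq by blast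
  have "c r \<notin> p"
  proof
    assume "c r \<in> p"
    then have "w \<in> p" using *(1,3) I_p p_prime submodule_overD(2) unfolding prime_in_def by blast
    then show False using assms by blast
  qed
  moreover have "0 \<in> p" using p_prime submodule_overD(1) unfolding prime_in_def by blast
  ultimately have "r \<noteq> 0" "c r \<in> D - p" using c_R[OF *(2)] cD(1) by auto
  then show thesis using that * by blast
qed

text \<open>Stability under all of \<open>L\<close>, not just \<open>D\<close>, holds because
  elements of \<open>L\<close> have numerators in \<open>T\<close> and \<open>I\<close> is an ideal
  of \<open>T\<close>.\<close>

lemma IW_submodule: "submodule_over L IW"
  unfolding submodule_over_def
proof (intro conjI ballI)
  have "0 = 0 / (1::'f)" by simp
  then show "0 \<in> IW" unfolding IW_def using submodule_overD(1)[OF I(1)] denominators(1) by blast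
next
  fix x y assume "x \<in> IW" "y \<in> IW"
  then obtain i w j v where *: "x = i / w" "y = j / v" "i \<in> I" "j \<in> I" "w \<in> D - p" "v \<in> D - p"
    unfolding IW_def by blast
  then have nz: "w \<noteq> 0" "v \<noteq> 0" using denominators(2) by metis+
  have "x + y = (v * i + w * j) / (w * v)" unfolding *(1,2)
    using nz by (simp add: field_simps)
  moreover have "v * i + w * j \<in> I" using * submodule_overD(2,3)[OF I(1)] D_T by blast
  ultimately show "x + y \<in> IW" unfolding IW_def using denominators(3) * by blast
next
  fix x y assume "x \<in> L" "y \<in> IW"
  then obtain j v where *: "y = j / v" "j \<in> I" "v \<in> D - p" unfolding IW_def by blast
  obtain a w where aw: "a \<in> T" "w \<in> D - p" "x = a / w"
    using overring_in_localization \<open>x \<in> L\<close> by blast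
  have "x * y = (a * j) / (w * v)" using * aw by simp
  then show "x * y \<in> IW"
    unfolding IW_def using denominators(3) * aw submodule_overD(3)[OF I(1)] by blast
qed

lemma IW_L: "IW \<subseteq> L"
  unfolding IW_def using I_D D_L inverse_L subring_setD(6)[OF L_subring] by (auto simp: divide_inverse)

lemma I_IW: "I \<subseteq> IW"
proof
  fix i assume "i \<in> I"
  moreover have "i = i / 1" by simp
  ultimately show "i \<in> IW" unfolding IW_def using denominators(1) by blast
qed

text \<open>Clearing the denominator produces \<open>c s * j\<close> with \<open>s\<close> arbitrary
  in the field. This product may leave \<open>I\<close> but stays in \<open>J\<close>, which is the
  purpose of \<open>J\<close>.\<close>

lemma c_IW:
  assumes "c s \<in> IW" shows "s = 0"
proof -
  obtain i w where *: "c s = i / w" "i \<in> I" "w \<in> D - p" using assms unfolding IW_def by blast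
  obtain r j where r: "w = c r + j" "j \<in> I" "r \<noteq> 0" using denominatorE[OF *(3)] by metis
  have "w \<noteq> 0" using * denominators(2) by auto
  then have "c s * (c r + j) = i" using *(1) r(1) by simp
  then have "c (s * r) = i - c s * j" by (simp add: cD algebra_simps)
  also have "\<dots> = i + c (- s) * j" by (simp add: cD)
  also have "\<dots> \<in> J" using submodule_overD(2,3)[OF J(1)] I(3) *(2) r(2) by blast
  finally show ?thesis using J(2) r(3) by fastforce
qed

lemma c_IW_eq: "c s - c t \<in> IW \<Longrightarrow> s = t"
  using c_IW[of "s - t"] by (simp add: cD)

text \<open>The residue of \<open>a / w\<close> is the quotient \<open>t / r\<close> of the constant
  parts: over the denominator \<open>w * c r\<close> the constant terms cancel and only members of
  \<open>I\<close> remain.\<close>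

lemma decomposition:
  assumes "l \<in> L"
  obtains s where "s \<in> frac_field R" "s \<in> L0" "l - c s \<in> IW"
proof -
  obtain a w where aw: "a \<in> T" "w \<in> D - p" "l = a / w" using overring_in_localization assms by blast
  obtain t i where a: "a = c t + i" "t \<in> S" "i \<in> I" using aw(1) unfolding T_eq by blast
  obtain r j where r: "w = c r + j" "r \<in> R" "j \<in> I" "r \<noteq> 0" "c r \<in> D - p" using denominatorE[OF aw(2)] by metis
  have "w \<noteq> 0" using aw denominators(2) by auto
  then have "l - c (t / r) = (c r * i - c t * j) / (w * c r)"
    unfolding aw(3) c_divide a(1) using r(1,4) c_eq_0_iff[of r]
    by (simp add: field_simps)
  moreover have "c r * i - c t * j \<in> I"
    using submodule_over_diff[OF T(1) I(1)] submodule_overD(3)[OF I(1)] c_S a r S(2) by blast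
  ultimately have *: "l - c (t / r) \<in> IW"
    unfolding IW_def using denominators(3)[OF aw(2) r(5)] by blast
  then have "l - (l - c (t / r)) \<in> L" using subring_setD(5)[OF L_subring assms] IW_L by blast
  then have "t / r \<in> L0" unfolding L0_def by simp
  moreover have "t / r \<in> frac_field R"
    using frac_field_divide[OF R, of t r] a(2) S(2,3) r(2) by blast
  ultimately show thesis using that * by blast
qed

lemma L0_subring: "subring_set L0"
  unfolding subring_set_def L0_def using subring_setD[OF L_subring] by (auto simp: cD)

lemma R_L0: "R \<subseteq> L0" unfolding L0_def using c_R D_L by blast

lemma overring_L0: "overring R L0"
proof -
  have "s \<in> frac_field R" if "s \<in> L0" for s
  proof -
    have "c s \<in> L" using \<open>s \<in> L0\<close> unfolding L0_def by blast
    then obtain t where "t \<in> frac_field R" "c s - c t \<in> IW" using decomposition[of "c s"] by metis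
    then show ?thesis using c_IW_eq by metis
  qed
  then show ?thesis unfolding overring_def is_subring_iff using L0_subring R_L0 by blast
qed

lemma submodule_pullback: "submodule_over L M \<Longrightarrow> submodule_over L0 {s. c s \<in> M}"
  unfolding submodule_over_def L0_def by (auto simp: cD)

lemma local_L0: "local_maximal L0 {s. c s \<in> m}"
  using m submodule_pullback[of m] unfolding local_maximal_def L0_def by (auto simp: cD c_inverse)

lemma prime_pullback: "prime_in L Q \<Longrightarrow> prime_in L0 {s. c s \<in> Q}"
  using submodule_pullback[of Q] unfolding prime_in_def L0_def by (auto simp: cD)

text \<open>The set is the preimage of \<open>Q\<close> under the projection from \<open>L\<close>
  to \<open>L0\<close>, and \<open>mult\<close> expresses that this projection is
  multiplicative.\<close>

lemma prime_lift_L: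
  assumes "prime_in L0 Q"
  shows "prime_in L {l \<in> L. \<exists>s\<in>Q. l - c s \<in> IW}" (is "prime_in L ?Q")
proof -
  have Q: "submodule_over L0 Q" "Q \<subseteq> L0" "1 \<notin> Q"
    "\<And>a b. a \<in> L0 \<Longrightarrow> b \<in> L0 \<Longrightarrow> a * b \<in> Q \<Longrightarrow> a \<in> Q \<or> b \<in> Q"
    using assms unfolding prime_in_def by auto
  have mult: "l * k - c (s * t) \<in> IW"
    if "l \<in> L" "k \<in> L" "s \<in> L0" "t \<in> L0" "l - c s \<in> IW" "k - c t \<in> IW" for l k s t
  proof -
    have "l * k - c (s * t) = l * (k - c t) + c t * (l - c s)" by (simp add: cD algebra_simps)
    then show ?thesis using submodule_overD(2,3)[OF IW_submodule] that unfolding L0_def by simp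
  qed
  show ?thesis
    unfolding prime_in_def
  proof (intro conjI ballI impI)
    show "submodule_over L ?Q"
      unfolding submodule_over_def
    proof (intro conjI ballI)
      have "0 - c 0 \<in> IW" using submodule_overD(1)[OF IW_submodule] by (simp add: cD)
      then show "0 \<in> ?Q" using submodule_overD(1)[OF Q(1)] subring_setD(1)[OF L_subring] by blast
    next
      fix x y assume "x \<in> ?Q" "y \<in> ?Q"
      then obtain s t where *: "x \<in> L" "y \<in> L" "s \<in> Q" "t \<in> Q" "x - c s \<in> IW" "y - c t \<in> IW" by blast
      have "x + y - c (s + t) = (x - c s) + (y - c t)" by (simp add: cD)
      then have "x + y - c (s + t) \<in> IW" using submodule_overD(2)[OF IW_submodule] * by metis
      then show "x + y \<in> ?Q" using submodule_overD(2)[OF Q(1)] subring_setD(4)[OF L_subring] * by blast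
    next
      fix x y assume "x \<in> L" "y \<in> ?Q"
      then obtain t where *: "y \<in> L" "t \<in> Q" "y - c t \<in> IW" by blast
      obtain s where s: "s \<in> L0" "x - c s \<in> IW" using decomposition[OF \<open>x \<in> L\<close>] by metis
      have "x * y - c (s * t) \<in> IW" using mult \<open>x \<in> L\<close> * s Q(2) by blast
      then show "x * y \<in> ?Q"
        using submodule_overD(3)[OF Q(1)] subring_setD(6)[OF L_subring] * s \<open>x \<in> L\<close> by blast
    qed
    show "?Q \<subseteq> L" by blast
    show "1 \<notin> ?Q"
    proof
      assume "1 \<in> ?Q"
      then obtain s where "s \<in> Q" "c 1 - c s \<in> IW" by (auto simp: cD)
      then show False using c_IW_eq Q(3) by blast
    qed
    fix x y assume xy: "x \<in> L" "y \<in> L" "x * y \<in> ?Q"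
    obtain s where s: "s \<in> L0" "x - c s \<in> IW" using decomposition[OF xy(1)] by metis
    obtain t where t: "t \<in> L0" "y - c t \<in> IW" using decomposition[OF xy(2)] by metis
    obtain u where u: "u \<in> Q" "x * y - c u \<in> IW" using xy(3) by blast
    have "c (s * t) - c u = (x * y - c u) - (x * y - c (s * t))" by simp
    then have "c (s * t) - c u \<in> IW"
      using submodule_over_diff[OF L_subring IW_submodule u(2) mult[OF xy(1,2) s(1) t(1) s(2) t(2)]] by metis
    then have "s * t \<in> Q" using c_IW_eq u(1) by blast
    then show "x \<in> ?Q \<or> y \<in> ?Q" using Q(4)[OF s(1) t(1)] s t xy by blast
  qed
qed

text \<open>The primes are lifted to \<open>D\<close> and \<open>L\<close>, where going-down holds,
  and the prime found there is pulled back along \<open>c\<close>. Uniqueness of residues,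
  \<open>c_IW_eq\<close>, makes both operations compatible with contraction to \<open>R\<close> and
  \<open>D\<close>.\<close>

lemma going_down_L0: "going_down R L0"
  unfolding going_down_iff[OF R L0_subring]
proof (intro allI impI, elim conjE)
  fix P1 P2 Q2
  assume P: "prime_in R P1" "prime_in R P2" "P1 \<subseteq> P2" and Q2: "prime_in L0 Q2" "Q2 \<inter> R = P2"
  define lift where "lift P = {c r + i | r i. r \<in> P \<and> i \<in> I}" for P
  define Q2' where "Q2' = {l \<in> L. \<exists>s\<in>Q2. l - c s \<in> IW}"
  have "Q2' \<inter> D = lift P2"
  proof (intro equalityI subsetI)
    fix d assume "d \<in> Q2' \<inter> D"
    then obtain s r i where *: "s \<in> Q2" "d - c s \<in> IW" "d = c r + i" "r \<in> R" "i \<in> I"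
      unfolding Q2'_def D_eq by blast
    have "c r - c s = (d - c s) - i" using * by simp
    then have "c r - c s \<in> IW" using submodule_over_diff[OF L_subring IW_submodule *(2), of i] I_IW *(5) by (metis subsetD)
    then have "r \<in> P2" using c_IW_eq * Q2(2) by blast
    then show "d \<in> lift P2" unfolding lift_def using * by blast
  next
    fix d assume "d \<in> lift P2"
    then obtain r i where *: "d = c r + i" "r \<in> P2" "i \<in> I" unfolding lift_def by blast
    then have "d \<in> D" "d - c r \<in> IW" "r \<in> Q2" using P(2) Q2(2) I_IW unfolding D_eq prime_in_def by auto
    then show "d \<in> Q2' \<inter> D" unfolding Q2'_def using D_L by blast
  qed
  moreover have "prime_in L Q2'" unfolding Q2'_def by (rule prime_lift_L[OF Q2(1)])
  moreover have "prime_in D (lift P1)" "prime_in D (lift P2)"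
    unfolding lift_def using P(1,2) by (blast intro: prime_in_lift)+
  moreover have "lift P1 \<subseteq> lift P2" unfolding lift_def using P(3) by blast
  ultimately obtain Q1 where Q1: "prime_in L Q1" "Q1 \<subseteq> Q2'" "Q1 \<inter> D = lift P1"
    using gd unfolding going_down_iff[OF D L_subring] by blast
  have "{s. c s \<in> Q1} \<subseteq> Q2" using Q1(2) c_IW_eq unfolding Q2'_def by blast
  moreover have "{s. c s \<in> Q1} \<inter> R = P1"
  proof (intro equalityI subsetI)
    fix s assume "s \<in> {s. c s \<in> Q1} \<inter> R"
    then have "c s \<in> lift P1" using Q1(3) c_R by blast
    then obtain r i where *: "c s = c r + i" "r \<in> P1" "i \<in> I" unfolding lift_def by blast
    then have "c s - c r \<in> IW" using I_IW by auto
    then show "s \<in> P1" using c_IW_eq *(2) by blast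
  next
    fix s assume s: "s \<in> P1"
    have "c s = c s + 0" by simp
    then have "c s \<in> lift P1" unfolding lift_def using s submodule_overD(1)[OF I(1)] by blast
    then show "s \<in> {s. c s \<in> Q1} \<inter> R" using Q1(3) P(1) s unfolding prime_in_def by blast
  qed
  ultimately show "\<exists>Q1. prime_in L0 Q1 \<and> Q1 \<subseteq> Q2 \<and> Q1 \<inter> R = P1"
    using prime_pullback[OF Q1(1)] by blast
qed

lemma overring_eq_localization_conductor:
  assumes "perinormal R"
  shows "L = localization_at D p"
proof (intro equalityI localization_subset subsetI)
  have "local_ring (subring_on L0)" using local_L0 local_ring_subring_on_iff[OF L0_subring] by blast
  then obtain P where P: "prime_in R P" "L0 = localization_at R P"
    using assms overring_L0 going_down_L0 unfolding perinormal_def primeideal_subring_on_iff[OF R] by blast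
  fix l assume "l \<in> L"
  then obtain s where s: "s \<in> L0" "l - c s \<in> IW" using decomposition by metis
  obtain a b where ab: "s = a / b" "a \<in> R" "b \<in> R - P" using s(1) unfolding P(2) localization_at_def by blast
  obtain i w where iw: "l - c s = i / w" "i \<in> I" "w \<in> D - p" using s(2) unfolding IW_def by blast
  have "b \<noteq> 0" using ab(3) P(1) submodule_overD(1) unfolding prime_in_def by blast
  then have cb: "c b \<noteq> 0" by (simp add: c_eq_0_iff)
  \<comment> \<open>The passage from \<open>P\<close> to \<open>p\<close> goes through units:
    \<open>b\<close> is invertible in \<open>L0\<close>, so \<open>c b\<close> is invertible in
    \<open>L\<close> and avoids \<open>m\<close>.\<close>
  have "1 / b \<in> L0" unfolding P(2) localization_at_def using subring_setD(2)[OF R] ab(3) by blast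
  then have "inverse (c b) \<in> L" unfolding L0_def by (simp add: c_inverse divide_inverse)
  then have "c b \<notin> m" using local_maximal_inverse_iff[OF m _ cb] c_R ab(3) D_L by blast
  then have b: "c b \<in> D - p" unfolding p_def using c_R ab(3) by blast
  have "w \<noteq> 0" using iw denominators(2) by auto
  have "l = i / w + c s" using iw(1) by (simp add: algebra_simps)
  also have "\<dots> = (c a * w + c b * i) / (c b * w)"
    unfolding ab(1) c_divide using cb \<open>w \<noteq> 0\<close> by (simp add: field_simps)
  finally have "l = (c a * w + c b * i) / (c b * w)" .
  moreover have "c a * w \<in> D" "c b * i \<in> D"
    using subring_setD(6)[OF D] c_R ab(2,3) iw(2,3) I_D by blast+
  then have "c a * w + c b * i \<in> D" by (rule subring_setD(4)[OF D])
  ultimately show "l \<in> localization_at D p"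
    unfolding localization_at_def using denominators(3)[OF b iw(3)] by blast
qed

end

end

theorem perinormal_pullback:
  assumes "perinormal R"
  shows "perinormal D"
  unfolding perinormal_def
proof (intro conjI allI impI, goal_cases)
  case 1
  show ?case using D is_subring_iff by blast
next
  case (2 L)
  then have L: "subring_set L" "overring D L" "going_down D L" unfolding overring_def is_subring_iff by auto
  obtain m where m: "local_maximal L m" using 2 local_ring_subring_on_iff[OF L(1)] by blast
  have "primeideal (m \<inter> D) (subring_on D)"
    using p_prime[OF L(2) m L(3)] primeideal_subring_on_iff[OF D] by blast
  moreover have "L = localization_at D (m \<inter> D)"
    using overring_eq_localization_no_conductor[OF L(2) m L(3)]
      overring_eq_localization_conductor[OF L(2) m L(3) _ assms] by blast
  ultimately show ?case by blast
qed

end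

section \<open>Adjoining multiples of an indeterminate\<close>

text \<open>With \<open>x\<close> as indeterminate and \<open>k\<close> as inclusion of constants,
  one argument covers polynomials and power series. The type \<open>'a\<close> stands for K[X] or
  K[[X]] over the field \<open>'k\<close>; both are Euclidean, and the pullback takes place in the
  fraction field.\<close>

lemma perinormal_const_plus_multiples:
  fixes R S :: "'k::field set" and T :: "'a::euclidean_ring set"
  assumes R: "subring_set R" and perinormal: "perinormal R" and S: "subring_set S" "R \<subseteq> S" "S \<subseteq> frac_field R"
    and k: "ring_map k" "\<And>s. x dvd k s \<Longrightarrow> s = 0"
    and T: "subring_set T" "noetherian_set T" "completely_integrally_closed T"
    and x: "x \<in> T" "x \<noteq> 0"
    and T_eq: "T = {k s + x * f | s f. s \<in> S \<and> f \<in> T}"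
  shows "perinormal (to_fract ` {k r + x * f | r f. r \<in> R \<and> f \<in> T})" (is "perinormal ?D")
proof -
  define I where "I = {to_fract (x * f) | f. f \<in> T}"
  \<comment> \<open>Here \<open>f\<close> is unrestricted: \<open>J\<close> has to absorb constants
    from all of \<open>'k\<close>, whereas \<open>I\<close> only admits cofactors in
    \<open>T\<close>.\<close>
  define J where "J = {to_fract (x * f) | f. True}"
  note kD = ring_mapD[OF k(1)]
  interpret conductor_square R S "\<lambda>s. to_fract (k s)" I J ?D "to_fract ` T"
  proof
    show "ring_map (\<lambda>s. to_fract (k s))" unfolding ring_map_def by (simp add: kD)
    show "subring_set (to_fract ` T)" "noetherian_set (to_fract ` T)"
      "completely_integrally_closed (to_fract ` T)"
      using T by (auto intro: subring_set_image noetherian_set_image ring_map_to_fract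
          completely_integrally_closed_to_fract)
    show "submodule_over (to_fract ` T) I"
      unfolding submodule_over_def
    proof (intro conjI ballI)
      show "0 \<in> I" unfolding I_def using subring_setD(1)[OF T(1)] by force
    next
      fix a b assume "a \<in> I" "b \<in> I"
      then obtain f g where *: "a = to_fract (x * f)" "b = to_fract (x * g)" "f \<in> T" "g \<in> T"
        unfolding I_def by blast
      then have "a + b = to_fract (x * (f + g))" by (simp add: algebra_simps)
      then show "a + b \<in> I" unfolding I_def using subring_setD(4)[OF T(1) *(3,4)] by blast
    next
      fix t a assume "t \<in> to_fract ` T" "a \<in> I"
      then obtain g f where *: "t = to_fract g" "a = to_fract (x * f)" "f \<in> T" "g \<in> T"
        unfolding I_def by blast
      then have "t * a = to_fract (x * (g * f))" by (simp add: algebra_simps)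
      then show "t * a \<in> I" unfolding I_def using subring_setD(6)[OF T(1) *(4,3)] by blast
    qed
    have "to_fract (x * 1) \<in> I" unfolding I_def using subring_setD(2)[OF T(1)] by blast
    then show "I \<noteq> {0}" using x(2) by auto
    show "I \<subseteq> J" unfolding I_def J_def by blast
    show "submodule_over (range (\<lambda>s. to_fract (k s))) J"
      unfolding submodule_over_def
    proof (intro conjI ballI)
      show "0 \<in> J" unfolding J_def by force
    next
      fix a b assume "a \<in> J" "b \<in> J"
      then obtain f g where *: "a = to_fract (x * f)" "b = to_fract (x * g)"
        unfolding J_def by blast
      then have "a + b = to_fract (x * (f + g))" by (simp add: algebra_simps)
      then show "a + b \<in> J" unfolding J_def by blast
    next
      fix t a assume "t \<in> range (\<lambda>s. to_fract (k s))" "a \<in> J"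
      then obtain s f where *: "t = to_fract (k s)" "a = to_fract (x * f)" unfolding J_def by blast
      then have "t * a = to_fract (x * (k s * f))" by (simp add: algebra_simps)
      then show "t * a \<in> J" unfolding J_def by blast
    qed
    show "s = 0" if "to_fract (k s) \<in> J" for s
      using that k(2)[of s] unfolding J_def by (auto simp del: to_fract_mult)
    have image: "to_fract ` {k s + x * f | s f. s \<in> A \<and> f \<in> T}
      = {to_fract (k s) + i | s i. s \<in> A \<and> i \<in> I}" for A
      unfolding I_def by (force simp del: to_fract_mult simp: image_iff)
    show "to_fract ` T = {to_fract (k s) + i | s i. s \<in> S \<and> i \<in> I}"
      using image[of S] T_eq by simp
    show "?D = {to_fract (k r) + i | r i. r \<in> R \<and> i \<in> I}" by (rule image)
  qed (use R S in auto)
  show ?thesis by (rule perinormal_pullback[OF perinormal])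
qed

lemma poly_over_eq:
  assumes "subring_set S"
  shows "poly_over S = {[:s:] + [:0, 1:] * f | s f. s \<in> S \<and> f \<in> poly_over S}"
proof (intro equalityI subsetI)
  fix p assume p: "p \<in> poly_over S"
  obtain a q where aq: "p = pCons a q" by (cases p)
  have "a \<in> S" using p unfolding poly_over_def aq by (auto dest: spec[of _ 0])
  moreover have "coeff q i \<in> S" for i
    using p unfolding poly_over_def aq by (auto dest: spec[of _ "Suc i"])
  then have "q \<in> poly_over S" unfolding poly_over_def by blast
  moreover have "p = [:a:] + [:0, 1:] * q" unfolding aq by simp
  ultimately show "p \<in> {[:s:] + [:0, 1:] * f | s f. s \<in> S \<and> f \<in> poly_over S}" by blast
qed (use subring_setD[OF assms] in \<open>auto simp: poly_over_def coeff_pCons split: nat.splits\<close>)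

lemma fps_over_eq:
  assumes "subring_set S"
  shows "fps_over S = {fps_const s + fps_X * f | s f. s \<in> S \<and> f \<in> fps_over S}"
proof (intro equalityI subsetI)
  fix p assume p: "p \<in> fps_over S"
  then have "fps_nth p 0 \<in> S" "fps_shift 1 p \<in> fps_over S" unfolding fps_over_def by auto
  moreover have "p = fps_const (fps_nth p 0) + fps_X * fps_shift 1 p"
    by (rule fps_ext) simp
  ultimately show "p \<in> {fps_const s + fps_X * f | s f. s \<in> S \<and> f \<in> fps_over S}" by blast
qed (use subring_setD[OF assms] in \<open>auto simp: fps_over_def\<close>)

theorem corollary2p6:
  fixes R S :: "'k::field set"
  assumes "is_subring R"
    and "noetherian_ring (subring_on R)"
    and "universally_catenary (subring_on R)"
    and "perinormal R"
    and "S = integral_closure R"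
    and "fin_gen_module R S"
  shows "perinormal (to_fract ` plus_X_poly R S) \<and>
    perinormal (to_fract ` plus_X_fps R S)"
proof
  have R: "subring_set R" using assms(1) is_subring_iff by blast
  have "noetherian_set R" using noetherian_subring_on[OF R assms(2)] .
  then have S: "subring_set S" "noetherian_set S" "completely_integrally_closed S"
    using finite_integral_closure[OF R] assms(5,6) by auto
  have RS: "R \<subseteq> S" "S \<subseteq> frac_field R"
    using subset_integral_closure[OF R] assms(5) unfolding integral_closure_eq by auto
  have "plus_X_poly R S = {[:r:] + [:0, 1:] * f | r f. r \<in> R \<and> f \<in> poly_over S}"
    unfolding plus_X_poly_def poly_over_def by simp
  moreover have "[:0, 1:] \<in> poly_over S"
    using subring_setD(1,2)[OF S(1)] unfolding poly_over_def by (auto simp: coeff_pCons split: nat.splits)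
  moreover have "s = 0" if "[:0, 1:] dvd [:s:]" for s :: 'k
    using that poly_eq_0_iff_dvd[of "[:s:]" 0] by simp
  ultimately show "perinormal (to_fract ` plus_X_poly R S)"
    using perinormal_const_plus_multiples[OF R assms(4) S(1) RS ring_map_const_poly _
        subring_set_poly_over[OF S(1)] noetherian_poly_over[OF S(1,2)]
        completely_integrally_closed_poly_over[OF S(1,3)] _ _ poly_over_eq[OF S(1)]] by simp
  have "plus_X_fps R S = {fps_const r + fps_X * f | r f. r \<in> R \<and> f \<in> fps_over S}"
    unfolding plus_X_fps_def fps_over_def by simp
  moreover have "fps_X \<in> fps_over S"
    using subring_setD(1,2)[OF S(1)] unfolding fps_over_def by (auto simp: fps_X_def)
  moreover have "s = 0" if "fps_X dvd fps_const s" for s :: 'k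
    using that by (auto elim!: dvdE dest: arg_cong[of _ _ "\<lambda>f. fps_nth f 0"])
  ultimately show "perinormal (to_fract ` plus_X_fps R S)"
    using perinormal_const_plus_multiples[OF R assms(4) S(1) RS ring_map_fps_const _
        subring_set_fps_over[OF S(1)] noetherian_fps_over[OF S(1,2)]
        completely_integrally_closed_fps_over[OF S(1,3)] _ _ fps_over_eq[OF S(1)]] by simp
qed

end
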